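(* Let $Sl_q(2)$ be the usual Hopf algebra with generators $a,b,c,d$, with product $m$. Let $\tilde\Delta$ and $\tilde\epsilon$ be the linear maps defined on the span of $a,b,c,d$ by $$\tilde\Delta a=b\otimes a+a\otimes c,\quad \tilde\Delta b=b\otimes b+a\otimes d,\quad \tilde\Delta c=c\otimes c+d\otimes a,\quad \tilde\Delta d=c\otimes d+d\otimes b,$$ $$\tilde\epsilon(a)=\tilde\epsilon(d)=0,\quad \tilde\epsilon(b)=\tilde\epsilon(c)=1.$$ Then the linear map $\tilde S$ defined by $b\mapsto -q^{-1}c$, $c\mapsto -qb$, $a\mapsto a$, $d\mapsto d$ verifies, on the span of $a,b,c,d$, $$m(id\otimes\tilde S)\tilde\Delta=m(\tilde S\otimes id)\tilde\Delta=1\cdot\tilde\epsilon.$$ Moreover, $\tilde S$ can be extended to a unital algebra map $Sl_q(2)\to Sl_q(2)$. Since $1,a,d$ and $bc$ are fixed points of $\tilde S$, the $q$-determinant $ad-q^{-1}bc$ of the matrix $U=\begin{pmatrix}a&b\\c&d\end{pmatrix}$ is invariant under $\tilde S$.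
   Context: The field $k$ is $\mathbb{R}$ or $\mathbb{C}$, and $q\in k\setminus\{0\}$. $Sl_q(2)$ is the unital associative $k$-algebra generated by $a,b,c,d$ with relations $$ab=q^{-1}ba,\quad ac=q^{-1}ca,\quad bd=q^{-1}db,\quad cd=q^{-1}dc,\quad bc=cb,$$ $$ad-da=(q^{-1}-q)bc,\quad ad-q^{-1}bc=1.$$ *)

theory Defs
  imports Complex_Main "HOL-Algebra.Module" "HOL-Algebra.QuotRing"
    "HOL-Algebra.Algebraic_Closure_Type"
    "HOL-Library.Poly_Mapping"
begin

text \<open>
  The ground field is the whole type \<open>'k\<close>, turned into an HOL-Algebra ring by
  \<^const>\<open>ring_of_type_algebra\<close>. Vector spaces and algebras are records of type
  \<open>('k, 'a) module\<close>. For a plain vector space the fields \<open>mult\<close> and \<open>one\<close> are meaningless.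
\<close>

abbreviation ground :: "'k::field ring" where
  "ground \<equiv> ring_of_type_algebra"

definition ground_module :: "('k::field, 'k) module" where
  "ground_module = \<lparr>carrier = UNIV, monoid.mult = (*), one = 1, ring.zero = 0, add = (+), module.smult = (*)\<rparr>"

definition linear_map ::
    "('k::field, 'a) module \<Rightarrow> ('k, 'b) module \<Rightarrow> ('a \<Rightarrow> 'b) \<Rightarrow> bool" where
  "linear_map M N f \<longleftrightarrow>
     f \<in> carrier M \<rightarrow> carrier N \<and>
     (\<forall>x\<in>carrier M. \<forall>y\<in>carrier M. f (x \<oplus>\<^bsub>M\<^esub> y) = f x \<oplus>\<^bsub>N\<^esub> f y) \<and>
     (\<forall>c. \<forall>x\<in>carrier M. f (c \<odot>\<^bsub>M\<^esub> x) = c \<odot>\<^bsub>N\<^esub> f x)"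

text \<open>\<^const>\<open>ring_hom\<close> includes preservation of the unit.\<close>

definition algebra_map ::
    "('k::field, 'a) module \<Rightarrow> ('k, 'b) module \<Rightarrow> ('a \<Rightarrow> 'b) \<Rightarrow> bool" where
  "algebra_map A B f \<longleftrightarrow> f \<in> ring_hom A B \<and> linear_map A B f"

definition lin_span :: "('k::field, 'a) module \<Rightarrow> 'a set \<Rightarrow> 'a set" where
  "lin_span M S = \<Inter>{H. submodule H ground M \<and> S \<subseteq> H}"

definition span_module :: "('k::field, 'a) module \<Rightarrow> 'a set \<Rightarrow> ('k, 'a) module" where
  "span_module M S = M\<lparr>carrier := lin_span M S\<rparr>"

text \<open>
  The quotient by \<open>N\<close>: a quotient algebra if \<open>N\<close> is a two-sided ideal (the ring part
  is then \<open>M Quot N\<close>), a quotient vector space if \<open>N\<close> is a subspace.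
\<close>

definition quot_module :: "('k::field, 'a) module \<Rightarrow> 'a set \<Rightarrow> ('k, 'a set) module" where
  "quot_module M N =
     \<lparr>carrier = a_rcosets\<^bsub>M\<^esub> N, monoid.mult = rcoset_mult M N, one = N +>\<^bsub>M\<^esub> \<one>\<^bsub>M\<^esub>,
      ring.zero = N, add = set_add M, module.smult = (\<lambda>c Y. \<Union>x\<in>Y. N +>\<^bsub>M\<^esub> (c \<odot>\<^bsub>M\<^esub> x))\<rparr>"

definition pm_scale :: "'k::field \<Rightarrow> ('x \<Rightarrow>\<^sub>0 'k) \<Rightarrow> ('x \<Rightarrow>\<^sub>0 'k)" where
  "pm_scale c f = Poly_Mapping.map ((*) c) f"

definition free_module :: "'x set \<Rightarrow> ('k::field, 'x \<Rightarrow>\<^sub>0 'k) module" where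
  "free_module Y =
     \<lparr>carrier = {f. Poly_Mapping.keys f \<subseteq> Y}, monoid.mult = (\<lambda>_ _. undefined), one = undefined,
      ring.zero = 0, add = (+), module.smult = pm_scale\<rparr>"

definition tensor_relators ::
    "('k::field, 'a) module \<Rightarrow> ('k, 'b) module \<Rightarrow> (('a \<times> 'b) \<Rightarrow>\<^sub>0 'k) set" where
  "tensor_relators M N =
     {Poly_Mapping.single (x \<oplus>\<^bsub>M\<^esub> x', y) 1
        - Poly_Mapping.single (x, y) 1 - Poly_Mapping.single (x', y) 1
      | x x' y. x \<in> carrier M \<and> x' \<in> carrier M \<and> y \<in> carrier N} \<union>
     {Poly_Mapping.single (x, y \<oplus>\<^bsub>N\<^esub> y') 1
        - Poly_Mapping.single (x, y) 1 - Poly_Mapping.single (x, y') 1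
      | x y y'. x \<in> carrier M \<and> y \<in> carrier N \<and> y' \<in> carrier N} \<union>
     {Poly_Mapping.single (c \<odot>\<^bsub>M\<^esub> x, y) 1 - Poly_Mapping.single (x, y) c
      | c x y. x \<in> carrier M \<and> y \<in> carrier N} \<union>
     {Poly_Mapping.single (x, c \<odot>\<^bsub>N\<^esub> y) 1 - Poly_Mapping.single (x, y) c
      | c x y. x \<in> carrier M \<and> y \<in> carrier N}"

definition tensor_null ::
    "('k::field, 'a) module \<Rightarrow> ('k, 'b) module \<Rightarrow> (('a \<times> 'b) \<Rightarrow>\<^sub>0 'k) set" where
  "tensor_null M N = lin_span (free_module (carrier M \<times> carrier N)) (tensor_relators M N)"

definition tensor ::
    "('k::field, 'a) module \<Rightarrow> ('k, 'b) module \<Rightarrow> ('k, (('a \<times> 'b) \<Rightarrow>\<^sub>0 'k) set) module" where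
  "tensor M N = quot_module (free_module (carrier M \<times> carrier N)) (tensor_null M N)"

definition pure_tensor ::
    "('k::field, 'a) module \<Rightarrow> ('k, 'b) module \<Rightarrow> 'a \<Rightarrow> 'b \<Rightarrow> (('a \<times> 'b) \<Rightarrow>\<^sub>0 'k) set" where
  "pure_tensor M N x y =
     tensor_null M N +>\<^bsub>free_module (carrier M \<times> carrier N)\<^esub> Poly_Mapping.single (x, y) 1"

text \<open>
  The linear map \<open>M \<otimes> N \<rightarrow> P\<close> induced by a bilinear \<open>\<beta>\<close>, by extending \<open>\<beta>\<close> linearly to
  representatives; all representatives of a class \<open>Y\<close> have the same image.
\<close>

definition tensor_lift ::
    "('k::field, 'c) module \<Rightarrow> ('a \<Rightarrow> 'b \<Rightarrow> 'c) \<Rightarrow> (('a \<times> 'b) \<Rightarrow>\<^sub>0 'k) set \<Rightarrow> 'c" where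
  "tensor_lift P \<beta> Y =
     the_elem ((\<lambda>f. \<Oplus>\<^bsub>P\<^esub>p\<in>Poly_Mapping.keys f.
                  Poly_Mapping.lookup f p \<odot>\<^bsub>P\<^esub> \<beta> (fst p) (snd p)) ` Y)"

text \<open>\<open>f \<otimes> g\<close>, where \<open>M'\<close> and \<open>N'\<close> are the codomains of \<open>f\<close> and \<open>g\<close>.\<close>

definition tensor_map ::
    "('k::field, 'c) module \<Rightarrow> ('k, 'd) module \<Rightarrow> ('a \<Rightarrow> 'c) \<Rightarrow> ('b \<Rightarrow> 'd) \<Rightarrow>
     (('a \<times> 'b) \<Rightarrow>\<^sub>0 'k) set \<Rightarrow> (('c \<times> 'd) \<Rightarrow>\<^sub>0 'k) set" where
  "tensor_map M' N' f g = tensor_lift (tensor M' N') (\<lambda>x y. pure_tensor M' N' (f x) (g y))"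

text \<open>The product of an algebra as a linear map \<open>A \<otimes> A \<rightarrow> A\<close>.\<close>

definition product_map :: "('k::field, 'a) module \<Rightarrow> (('a \<times> 'a) \<Rightarrow>\<^sub>0 'k) set \<Rightarrow> 'a" where
  "product_map A = tensor_lift A (monoid.mult A)"

datatype 'x word = Word "'x list"

instantiation word :: (type) monoid_add
begin

definition zero_word :: "'a word" where
  "zero_word = Word []"

fun plus_word :: "'a word \<Rightarrow> 'a word \<Rightarrow> 'a word" where
  "plus_word (Word u) (Word v) = Word (u @ v)"

instance
proof
  fix x y z :: "'a word"
  show "x + y + z = x + (y + z)" by (cases x; cases y; cases z) simp
  show "0 + x = x" by (cases x) (simp add: zero_word_def)
  show "x + 0 = x" by (cases x) (simp add: zero_word_def)
qed

end

text \<open>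
  As words form a monoid (written additively, with concatenation as \<open>+\<close>), the multiplication
  of \<open>'x word \<Rightarrow>\<^sub>0 'k\<close> provided by \<open>Poly_Mapping\<close> is that of the monoid algebra, so this is
  the free associative unital algebra on \<open>'x\<close>.
\<close>

definition free_algebra :: "('k::field, 'x word \<Rightarrow>\<^sub>0 'k) module" where
  "free_algebra = \<lparr>carrier = UNIV, monoid.mult = (*), one = 1, ring.zero = 0, add = (+), module.smult = pm_scale\<rparr>"

definition free_gen :: "'x \<Rightarrow> ('x word \<Rightarrow>\<^sub>0 'k::field)" where
  "free_gen x = Poly_Mapping.single (Word [x]) 1"

datatype slq_letter = La | Lb | Lc | Ld

definition slq_relators :: "'k::field \<Rightarrow> (slq_letter word \<Rightarrow>\<^sub>0 'k) set" where
  "slq_relators q =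
     (let a = free_gen La; b = free_gen Lb; c = free_gen Lc; d = free_gen Ld in
      {a * b - pm_scale (inverse q) (b * a),
       a * c - pm_scale (inverse q) (c * a),
       b * d - pm_scale (inverse q) (d * b),
       c * d - pm_scale (inverse q) (d * c),
       b * c - c * b,
       a * d - d * a - pm_scale (inverse q - q) (b * c),
       a * d - pm_scale (inverse q) (b * c) - 1})"

text \<open>\<^const>\<open>genideal\<close> is the two-sided ideal generated by a set.\<close>

definition slq_ideal :: "'k::field \<Rightarrow> (slq_letter word \<Rightarrow>\<^sub>0 'k) set" where
  "slq_ideal q = Idl\<^bsub>free_algebra\<^esub> (slq_relators q)"

definition Slq :: "'k::field \<Rightarrow> ('k, (slq_letter word \<Rightarrow>\<^sub>0 'k) set) module" where
  "Slq q = quot_module free_algebra (slq_ideal q)"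

definition slq_gen :: "'k::field \<Rightarrow> slq_letter \<Rightarrow> (slq_letter word \<Rightarrow>\<^sub>0 'k) set" where
  "slq_gen q x = slq_ideal q +>\<^bsub>free_algebra\<^esub> free_gen x"

definition slq_gen_span :: "'k::field \<Rightarrow> ('k, (slq_letter word \<Rightarrow>\<^sub>0 'k) set) module" where
  "slq_gen_span q = span_module (Slq q) {slq_gen q La, slq_gen q Lb, slq_gen q Lc, slq_gen q Ld}"

text \<open>The \<open>q\<close>-determinant \<open>x w - q\<^sup>-\<^sup>1 y z\<close> of the matrix with rows \<open>(x, y)\<close> and \<open>(z, w)\<close>.\<close>

definition qdet :: "('k::field, 'a) module \<Rightarrow> 'k \<Rightarrow> 'a \<Rightarrow> 'a \<Rightarrow> 'a \<Rightarrow> 'a \<Rightarrow> 'a" where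
  "qdet A q x y z w = (x \<otimes>\<^bsub>A\<^esub> w) \<ominus>\<^bsub>A\<^esub> (inverse q \<odot>\<^bsub>A\<^esub> (y \<otimes>\<^bsub>A\<^esub> z))"

text \<open>
  These maps live on the span \<open>V\<close> of the four generators only: \<open>\<Delta>\<close> maps \<open>V\<close> to \<open>V \<otimes> V\<close>, so that
  \<open>id \<otimes> S\<close> and \<open>S \<otimes> id\<close> can be applied to \<open>\<Delta> x\<close>. That such linear maps exist depends on the
  linear independence of the generators and is not built into the predicates.
\<close>

definition is_Delta_tilde ::
    "'k::field \<Rightarrow> ((slq_letter word \<Rightarrow>\<^sub>0 'k) set \<Rightarrow>
       (((slq_letter word \<Rightarrow>\<^sub>0 'k) set \<times> (slq_letter word \<Rightarrow>\<^sub>0 'k) set) \<Rightarrow>\<^sub>0 'k) set) \<Rightarrow> bool" where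
  "is_Delta_tilde q \<Delta> \<longleftrightarrow>
     (let V = slq_gen_span q; T = tensor V V; t = pure_tensor V V;
          a = slq_gen q La; b = slq_gen q Lb; c = slq_gen q Lc; d = slq_gen q Ld in
      linear_map V T \<Delta> \<and>
      \<Delta> a = t b a \<oplus>\<^bsub>T\<^esub> t a c \<and>
      \<Delta> b = t b b \<oplus>\<^bsub>T\<^esub> t a d \<and>
      \<Delta> c = t c c \<oplus>\<^bsub>T\<^esub> t d a \<and>
      \<Delta> d = t c d \<oplus>\<^bsub>T\<^esub> t d b)"

definition is_eps_tilde :: "'k::field \<Rightarrow> ((slq_letter word \<Rightarrow>\<^sub>0 'k) set \<Rightarrow> 'k) \<Rightarrow> bool" where
  "is_eps_tilde q \<epsilon> \<longleftrightarrow>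
     linear_map (slq_gen_span q) ground_module \<epsilon> \<and>
     \<epsilon> (slq_gen q La) = 0 \<and> \<epsilon> (slq_gen q Ld) = 0 \<and>
     \<epsilon> (slq_gen q Lb) = 1 \<and> \<epsilon> (slq_gen q Lc) = 1"

definition is_S_tilde ::
    "'k::field \<Rightarrow> ((slq_letter word \<Rightarrow>\<^sub>0 'k) set \<Rightarrow> (slq_letter word \<Rightarrow>\<^sub>0 'k) set) \<Rightarrow> bool" where
  "is_S_tilde q S \<longleftrightarrow>
     linear_map (slq_gen_span q) (Slq q) S \<and>
     S (slq_gen q Lb) = (- inverse q) \<odot>\<^bsub>Slq q\<^esub> slq_gen q Lc \<and>
     S (slq_gen q Lc) = (- q) \<odot>\<^bsub>Slq q\<^esub> slq_gen q Lb \<and>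
     S (slq_gen q La) = slq_gen q La \<and>
     S (slq_gen q Ld) = slq_gen q Ld"

end

theory Submission
  imports Defs
begin

text \<open>
  The algebra is a quotient of a free algebra, so algebra maps out of it are the same as families of
  four elements satisfying the defining relations (\<open>Slq_universal\<close>). The statement rests on two uses
  of this universal property and on a computation with the relations.

  Existence of \<open>\<Delta>\<close>, \<open>\<epsilon>\<close> and \<open>S\<close> as linear maps on the span of \<open>a, b, c, d\<close> requires that these four
  generators are linearly independent. This is shown by functionals dual to the generators
  (\<open>Slq_dual_functional\<close>), taken from the entries of representations by upper triangular matrices of
  size two. The representation with \<open>a = diag(1, q)\<close>, \<open>d = diag(1, inverse q)\<close> and \<open>b\<close>, \<open>c\<close> multiples of the
  off-diagonal matrix unit separates \<open>b\<close> and \<open>c\<close>; the one with \<open>b = c = 0\<close> and \<open>a\<close> unipotent with inverse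
  \<open>d\<close> separates \<open>a\<close> and \<open>d\<close>. Any prescribed values on the generators then extend linearly
  (\<open>linear_map_from_slq_gen_span\<close>).

  The antipode identities compare linear maps on the span, so they need only be checked on the
  generators (\<open>convolution_eqI\<close>). Once the universal property of the tensor product (\<open>tensor_lift\<close>) shows that
  \<open>m (f \<otimes> g)\<close> is linear and sends \<open>x \<otimes> y\<close> to \<open>f x \<cdot> g y\<close>, they become eight identities
  (\<open>antipode_identities\<close>). Four of them are \<open>q\<close>-commutation relations, such as \<open>ba - q ab = 0\<close>; the other
  four are the two forms \<open>ad - inverse q bc = 1\<close> and \<open>da - q bc = 1\<close> of the determinant relation.

  The antipode extends to an algebra map because the images \<open>a\<close>, \<open>- inverse q c\<close>, \<open>- q b\<close>, \<open>d\<close> of the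
  generators satisfy the defining relations again (\<open>antipode_gen_relations\<close>), and every algebra map
  preserves the \<open>q\<close>-determinant since it equals \<open>1\<close> (\<open>qdet_eq_one\<close>).
\<close>

section \<open>Vector spaces and linear maps\<close>

lemmas ground_simps = ring_of_type_algebra_def

lemma moduleI_ground:
  fixes M :: "('k::field, 'a) module" (structure)
  assumes "abelian_group M"
    and "\<And>c x. x \<in> carrier M \<Longrightarrow> c \<odot> x \<in> carrier M"
    and "\<And>c e x. x \<in> carrier M \<Longrightarrow> (c + e) \<odot> x = c \<odot> x \<oplus> e \<odot> x"
    and "\<And>c x y. \<lbrakk>x \<in> carrier M; y \<in> carrier M\<rbrakk> \<Longrightarrow> c \<odot> (x \<oplus> y) = c \<odot> x \<oplus> c \<odot> y"
    and "\<And>c e x. x \<in> carrier M \<Longrightarrow> (c * e) \<odot> x = c \<odot> (e \<odot> x)"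
    and "\<And>x. x \<in> carrier M \<Longrightarrow> 1 \<odot> x = x"
  shows "module ground M"
  by (rule moduleI) (use assms in \<open>auto simp: ground_simps cring_from_type_algebra[unfolded ground_simps]\<close>)

lemma module_groundD:
  fixes M :: "('k::field, 'a) module" (structure)
  assumes "module ground M" and x: "x \<in> carrier M"
  shows "c \<odot> x \<in> carrier M"
    and "(c + e) \<odot> x = c \<odot> x \<oplus> e \<odot> x"
    and "y \<in> carrier M \<Longrightarrow> c \<odot> (x \<oplus> y) = c \<odot> x \<oplus> c \<odot> y"
    and "(c * e) \<odot> x = c \<odot> (e \<odot> x)"
    and "1 \<odot> x = x"
    and "0 \<odot> x = \<zero>"
    and "(- c) \<odot> x = \<ominus> (c \<odot> x)"
    and "c \<odot> \<zero> = \<zero>"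
proof -
  interpret module ground M by fact
  have *: "a \<in> carrier ground" for a :: 'k by (simp add: ground_simps)
  show "c \<odot> x \<in> carrier M" using x * by simp
  show "(c + e) \<odot> x = c \<odot> x \<oplus> e \<odot> x"
    using smult_l_distr[OF * * x, of c e] by (simp add: ground_simps)
  show "c \<odot> (x \<oplus> y) = c \<odot> x \<oplus> c \<odot> y" if "y \<in> carrier M"
    using smult_r_distr[OF * x that] .
  show "(c * e) \<odot> x = c \<odot> (e \<odot> x)"
    using smult_assoc1[OF * * x, of c e] by (simp add: ground_simps)
  show "1 \<odot> x = x" using smult_one[OF x] by (simp add: ground_simps)
  show z: "0 \<odot> x = \<zero>" using smult_l_null[OF x] by (simp add: ground_simps)
  show "c \<odot> \<zero> = \<zero>" using smult_r_null[OF *] .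
  have "(- c) \<odot> x \<oplus> c \<odot> x = \<zero>"
    using smult_l_distr[OF * * x, of "-c" c] z by (simp add: ground_simps)
  then show "(- c) \<odot> x = \<ominus> (c \<odot> x)"
    using x * by (simp add: M.minus_equality)
qed

lemma submodule_groundI:
  fixes M :: "('k::field, 'a) module" (structure)
  assumes M: "module ground M" and "H \<subseteq> carrier M" and "\<zero> \<in> H"
    and add: "\<And>x y. \<lbrakk>x \<in> H; y \<in> H\<rbrakk> \<Longrightarrow> x \<oplus> y \<in> H"
    and smult: "\<And>c x. x \<in> H \<Longrightarrow> c \<odot> x \<in> H"
  shows "submodule H ground M"
proof -
  interpret module ground M by fact
  have "\<ominus> x \<in> H" if "x \<in> H" for x
  proof -
    have x: "x \<in> carrier M" using that assms(2) by blast
    have "(- 1) \<odot> x = \<ominus> x"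
      using module_groundD(5,7)[OF M x] by simp
    then show ?thesis using smult[OF that, of "- 1"] by simp
  qed
  then show ?thesis using assms by (intro submoduleI) auto
qed

lemma submodule_groundD:
  fixes M :: "('k::field, 'a) module" (structure)
  assumes "module ground M" and "submodule H ground M"
  shows "H \<subseteq> carrier M" and "\<zero> \<in> H"
    and "\<lbrakk>x \<in> H; y \<in> H\<rbrakk> \<Longrightarrow> x \<oplus> y \<in> H"
    and "x \<in> H \<Longrightarrow> c \<odot> x \<in> H"
proof -
  interpret module ground M by fact
  interpret submodule H ground M by fact
  show "H \<subseteq> carrier M" using subset by simp
  show "\<zero> \<in> H" using one_closed by simp
  show "\<lbrakk>x \<in> H; y \<in> H\<rbrakk> \<Longrightarrow> x \<oplus> y \<in> H" using m_closed by simp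
  show "x \<in> H \<Longrightarrow> c \<odot> x \<in> H" by (simp add: ground_simps)
qed

lemma linear_mapI:
  assumes "\<And>x. x \<in> carrier M \<Longrightarrow> f x \<in> carrier N"
    and "\<And>x y. \<lbrakk>x \<in> carrier M; y \<in> carrier M\<rbrakk> \<Longrightarrow> f (x \<oplus>\<^bsub>M\<^esub> y) = f x \<oplus>\<^bsub>N\<^esub> f y"
    and "\<And>c x. x \<in> carrier M \<Longrightarrow> f (c \<odot>\<^bsub>M\<^esub> x) = c \<odot>\<^bsub>N\<^esub> f x"
  shows "linear_map M N f"
  using assms by (auto simp: linear_map_def)

lemma linear_mapD:
  assumes "linear_map M N f" and "x \<in> carrier M"
  shows "f x \<in> carrier N"
    and "y \<in> carrier M \<Longrightarrow> f (x \<oplus>\<^bsub>M\<^esub> y) = f x \<oplus>\<^bsub>N\<^esub> f y"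
    and "f (c \<odot>\<^bsub>M\<^esub> x) = c \<odot>\<^bsub>N\<^esub> f x"
  using assms by (auto simp: linear_map_def)

lemma linear_map_zero:
  assumes "module ground M" "module ground N" "linear_map M N f"
  shows "f \<zero>\<^bsub>M\<^esub> = \<zero>\<^bsub>N\<^esub>"
proof -
  interpret M: module ground M by fact
  have "f (0 \<odot>\<^bsub>M\<^esub> \<zero>\<^bsub>M\<^esub>) = 0 \<odot>\<^bsub>N\<^esub> f \<zero>\<^bsub>M\<^esub>"
    using assms(3) linear_mapD(3) M.zero_closed by metis
  then show ?thesis
    using module_groundD(6)[OF assms(1) M.zero_closed]
      module_groundD(6)[OF assms(2) linear_mapD(1)[OF assms(3) M.zero_closed]] by simp
qed

lemma linear_map_compose:
  assumes "linear_map M N f" "linear_map N P g"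
  shows "linear_map M P (\<lambda>x. g (f x))"
  using assms by (auto simp: linear_map_def Pi_iff)

text \<open>Equalizers serve to transport identities from a spanning set, kernels to factor maps through
  quotients.\<close>

lemma linear_map_equalizer_submodule:
  assumes M: "module ground M" and N: "module ground N"
    and f: "linear_map M N f" and g: "linear_map M N g"
  shows "submodule {x \<in> carrier M. f x = g x} ground M"
proof -
  interpret M: module ground M by fact
  show ?thesis
    by (rule submodule_groundI[OF M])
      (use f g M in \<open>auto simp: linear_mapD linear_map_zero[OF M N] module_groundD(1)\<close>)
qed

lemma linear_map_kernel_submodule:
  assumes M: "module ground M" and N: "module ground N" and f: "linear_map M N f"
  shows "submodule {x \<in> carrier M. f x = \<zero>\<^bsub>N\<^esub>} ground M"
proof -
  interpret N: module ground N by fact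
  have "linear_map M N (\<lambda>_. \<zero>\<^bsub>N\<^esub>)"
    by (rule linear_mapI) (auto simp: module_groundD(8)[OF N N.zero_closed])
  from linear_map_equalizer_submodule[OF M N f this] show ?thesis .
qed

section \<open>Spans\<close>

lemma lin_span_minimal:
  "\<lbrakk>submodule H ground M; S \<subseteq> H\<rbrakk> \<Longrightarrow> lin_span M S \<subseteq> H"
  by (auto simp: lin_span_def)

lemma lin_span_superset: "S \<subseteq> lin_span M S"
  by (auto simp: lin_span_def)

lemma lin_span_submodule:
  fixes M :: "('k::field, 'a) module"
  assumes M: "module ground M" and S: "S \<subseteq> carrier M"
  shows "submodule (lin_span M S) ground M"
proof (rule submodule_groundI[OF M])
  interpret M: module ground M by fact
  show "lin_span M S \<subseteq> carrier M"
    using lin_span_minimal[OF M.carrier_is_submodule S] .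
qed (auto simp: lin_span_def submodule_groundD[OF M])

lemma span_module_module:
  assumes "module ground M" and "S \<subseteq> carrier M"
  shows "module ground (span_module M S)"
  unfolding span_module_def
  using submodule.submodule_is_module[OF lin_span_submodule[OF assms] assms(1)] .

lemma span_module_simps [simp]:
  "carrier (span_module M S) = lin_span M S"
  "add (span_module M S) = add M" "module.smult (span_module M S) = module.smult M"
  "ring.zero (span_module M S) = ring.zero M"
  by (simp_all add: span_module_def)

lemma linear_map_restrict_span:
  assumes "module ground M" and "S \<subseteq> carrier M" and "linear_map M N f"
  shows "linear_map (span_module M S) N f"
  using assms(3) submodule_groundD(1)[OF assms(1) lin_span_submodule[OF assms(1,2)]]
  by (auto simp: linear_map_def Pi_iff subset_iff)

text \<open>The elements where two linear maps agree form a subspace. Every identity on the span of the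
  generators below is reduced in this way to the four generators.\<close>

lemma linear_map_eq_on_span:
  assumes M: "module ground M" and S: "S \<subseteq> carrier M" and N: "module ground N"
    and f: "linear_map (span_module M S) N f" and g: "linear_map (span_module M S) N g"
    and eq: "\<And>s. s \<in> S \<Longrightarrow> f s = g s" and x: "x \<in> lin_span M S"
  shows "f x = g x"
proof -
  let ?H = "{x \<in> lin_span M S. f x = g x}"
  have V: "module ground (span_module M S)" using span_module_module[OF M S] .
  have H: "submodule ?H ground (span_module M S)"
    using linear_map_equalizer_submodule[OF V N f g] by simp
  have sub: "lin_span M S \<subseteq> carrier M"
    using submodule_groundD(1)[OF M lin_span_submodule[OF M S]] .
  have "submodule ?H ground M"
    by (rule submodule_groundI[OF M])
      (use submodule_groundD[OF V H] sub in auto)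
  then have "lin_span M S \<subseteq> ?H"
    by (rule lin_span_minimal) (use eq lin_span_superset[of S M] in auto)
  with x show ?thesis by auto
qed

section \<open>Quotients\<close>

lemma quot_module_simps [simp]:
  "carrier (quot_module M N) = a_rcosets\<^bsub>M\<^esub> N"
  "add (quot_module M N) = set_add M"
  "ring.zero (quot_module M N) = N"
  "monoid.mult (quot_module M N) = rcoset_mult M N"
  "monoid.one (quot_module M N) = N +>\<^bsub>M\<^esub> \<one>\<^bsub>M\<^esub>"
  by (simp_all add: quot_module_def)

locale subspace =
  fixes M :: "('k::field, 'a) module" (structure) and N :: "'a set"
  assumes M: "module ground M" and N: "submodule N ground M"
begin

sublocale M: module ground M by (fact M)
sublocale N: abelian_subgroup N M
proof (rule abelian_subgroupI3)
  show "additive_subgroup N M"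
    using N by (simp add: additive_subgroup_def submodule_def)
qed (rule M.abelian_group_axioms)

lemma mem_coset_iff: "\<lbrakk>x \<in> carrier M; y \<in> carrier M\<rbrakk> \<Longrightarrow> y \<in> N +> x \<longleftrightarrow> y \<ominus> x \<in> N"
  by (simp add: N.a_rcos_module a_minus_def)

lemma coset_eqI: "\<lbrakk>x \<in> carrier M; y \<in> carrier M; y \<ominus> x \<in> N\<rbrakk> \<Longrightarrow> N +> x = N +> y"
  by (simp add: mem_coset_iff N.a_repr_independence')

lemma coset_in_carrier: "x \<in> carrier M \<Longrightarrow> N +> x \<in> carrier (quot_module M N)"
  by (simp add: M.a_rcosetsI N.a_subset)

lemma carrier_cases:
  assumes "Y \<in> carrier (quot_module M N)"
  obtains x where "x \<in> carrier M" "Y = N +> x"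
  using assms by (auto simp: A_RCOSETS_def' a_r_coset_def')

lemma smult_coset:
  assumes x: "x \<in> carrier M"
  shows "c \<odot>\<^bsub>quot_module M N\<^esub> (N +> x) = N +> (c \<odot> x)"
proof -
  have "N +> (c \<odot> y) = N +> (c \<odot> x)" if y: "y \<in> N +> x" for y
  proof -
    have yc: "y \<in> carrier M" using N.a_elemrcos_carrier[OF x y] .
    have "y \<ominus> x \<in> N" using mem_coset_iff[OF x yc] y by simp
    then have "c \<odot> (y \<ominus> x) \<in> N" by (rule submodule_groundD(4)[OF M N])
    moreover have "c \<odot> (y \<ominus> x) = c \<odot> y \<ominus> c \<odot> x"
      using module_groundD[OF M] x yc M.smult_r_minus[of c x]
      by (simp add: a_minus_def ground_simps)
    ultimately show ?thesis
      using coset_eqI[of "c \<odot> x" "c \<odot> y"] x yc module_groundD(1)[OF M] by simp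
  qed
  moreover have "x \<in> N +> x" using N.a_rcos_self[OF x] .
  ultimately have "(\<Union>y\<in>N +> x. N +> (c \<odot> y)) = N +> (c \<odot> x)" by blast
  then show ?thesis by (simp add: quot_module_def)
qed

lemma add_coset:
  "\<lbrakk>x \<in> carrier M; y \<in> carrier M\<rbrakk> \<Longrightarrow> (N +> x) \<oplus>\<^bsub>quot_module M N\<^esub> (N +> y) = N +> (x \<oplus> y)"
  by (simp add: N.a_rcos_sum)

lemma coset_zero: "N +> \<zero> = N"
  using N.a_rcos_const[OF N.zero_closed] .

lemma projection_linear: "linear_map M (quot_module M N) ((+>) N)"
  by (rule linear_mapI) (use coset_in_carrier add_coset smult_coset in auto)

lemma quot_module_module: "module ground (quot_module M N)"
proof (rule moduleI_ground)
  let ?Q = "quot_module M N"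
  note [simp del] = quot_module_simps
  note mod = module_groundD[OF M]
  note [simp] = add_coset smult_coset coset_in_carrier mod(1)
  have zero: "\<zero>\<^bsub>?Q\<^esub> = N +> \<zero>" by (simp add: coset_zero quot_module_simps)
  show "abelian_group ?Q"
  proof (rule abelian_groupI)
    show "\<zero>\<^bsub>?Q\<^esub> \<in> carrier ?Q" by (simp only: zero coset_in_carrier M.zero_closed)
  next
    fix A assume "A \<in> carrier ?Q"
    then obtain x where x: "x \<in> carrier M" "A = N +> x" by (rule carrier_cases)
    then have "(N +> (\<ominus> x)) \<oplus>\<^bsub>?Q\<^esub> A = N +> \<zero>" by (simp add: M.l_neg)
    with x show "\<exists>B\<in>carrier ?Q. B \<oplus>\<^bsub>?Q\<^esub> A = \<zero>\<^bsub>?Q\<^esub>"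
      unfolding zero by (meson M.a_inv_closed coset_in_carrier)
    have "(N +> \<zero>) \<oplus>\<^bsub>?Q\<^esub> A = A" using x by simp
    then show "\<zero>\<^bsub>?Q\<^esub> \<oplus>\<^bsub>?Q\<^esub> A = A" by (simp only: zero)
    fix B assume "B \<in> carrier ?Q"
    then obtain y where y: "y \<in> carrier M" "B = N +> y" by (rule carrier_cases)
    show "A \<oplus>\<^bsub>?Q\<^esub> B \<in> carrier ?Q" "A \<oplus>\<^bsub>?Q\<^esub> B = B \<oplus>\<^bsub>?Q\<^esub> A"
      using x y by (simp_all add: M.a_comm)
    fix C assume "C \<in> carrier ?Q"
    then obtain z where z: "z \<in> carrier M" "C = N +> z" by (rule carrier_cases)
    show "(A \<oplus>\<^bsub>?Q\<^esub> B) \<oplus>\<^bsub>?Q\<^esub> C = A \<oplus>\<^bsub>?Q\<^esub> (B \<oplus>\<^bsub>?Q\<^esub> C)"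
      using x y z by (simp add: M.a_assoc)
  qed
  fix A assume "A \<in> carrier ?Q"
  then obtain x where x: "x \<in> carrier M" "A = N +> x" by (rule carrier_cases)
  show "c \<odot>\<^bsub>?Q\<^esub> A \<in> carrier ?Q"
    and "(c + e) \<odot>\<^bsub>?Q\<^esub> A = c \<odot>\<^bsub>?Q\<^esub> A \<oplus>\<^bsub>?Q\<^esub> e \<odot>\<^bsub>?Q\<^esub> A"
    and "(c * e) \<odot>\<^bsub>?Q\<^esub> A = c \<odot>\<^bsub>?Q\<^esub> (e \<odot>\<^bsub>?Q\<^esub> A)"
    and "1 \<odot>\<^bsub>?Q\<^esub> A = A" for c e
    using x by (simp_all add: mod(2,4,5))
  fix B assume "B \<in> carrier ?Q"
  then obtain y where y: "y \<in> carrier M" "B = N +> y" by (rule carrier_cases)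
  show "c \<odot>\<^bsub>?Q\<^esub> (A \<oplus>\<^bsub>?Q\<^esub> B) = c \<odot>\<^bsub>?Q\<^esub> A \<oplus>\<^bsub>?Q\<^esub> c \<odot>\<^bsub>?Q\<^esub> B" for c
    using x y by (simp add: mod(3))
qed

text \<open>The image of a coset under a map that vanishes on the subspace is a singleton, so
  \<^const>\<open>the_elem\<close> picks a well-defined value. In this form \<^const>\<open>tensor_lift\<close> is an instance.\<close>

lemma quot_lift:
  assumes P: "module ground P" and h: "linear_map M P h" and null: "\<And>x. x \<in> N \<Longrightarrow> h x = \<zero>\<^bsub>P\<^esub>"
  shows quot_lift_coset: "x \<in> carrier M \<Longrightarrow> the_elem (h ` (N +> x)) = h x"
    and quot_lift_linear: "linear_map (quot_module M N) P (\<lambda>Y. the_elem (h ` Y))"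
proof -
  interpret P: module ground P by fact
  have *: "the_elem (h ` (N +> x)) = h x" if x: "x \<in> carrier M" for x
  proof -
    have "h y = h x" if y: "y \<in> N +> x" for y
    proof -
      obtain n where n: "n \<in> N" "y = n \<oplus> x" using y by (auto simp: a_r_coset_def')
      then have "n \<in> carrier M" by simp
      then show ?thesis
        using n x null by (simp add: linear_mapD(1,2)[OF h])
    qed
    then have "h ` (N +> x) = {h x}" using N.a_rcos_self[OF x] by blast
    then show ?thesis by simp
  qed
  show "the_elem (h ` (N +> x)) = h x" if "x \<in> carrier M" for x using *[OF that] .
  show "linear_map (quot_module M N) P (\<lambda>Y. the_elem (h ` Y))"
  proof (rule linear_mapI)
    fix A assume "A \<in> carrier (quot_module M N)"
    then obtain x where x: "x \<in> carrier M" "A = N +> x" by (rule carrier_cases)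
    show "the_elem (h ` A) \<in> carrier P"
      using x by (simp add: * linear_mapD(1)[OF h])
    show "the_elem (h ` (c \<odot>\<^bsub>quot_module M N\<^esub> A)) = c \<odot>\<^bsub>P\<^esub> the_elem (h ` A)" for c
      using x by (simp add: * smult_coset module_groundD(1)[OF M] linear_mapD(3)[OF h])
    fix B assume "B \<in> carrier (quot_module M N)"
    then obtain y where y: "y \<in> carrier M" "B = N +> y" by (rule carrier_cases)
    have "A \<oplus>\<^bsub>quot_module M N\<^esub> B = N +> (x \<oplus> y)" using x y by (simp only: add_coset)
    then show "the_elem (h ` (A \<oplus>\<^bsub>quot_module M N\<^esub> B)) = the_elem (h ` A) \<oplus>\<^bsub>P\<^esub> the_elem (h ` B)"
      using x y by (simp add: * linear_mapD(2)[OF h] del: quot_module_simps)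
  qed
qed

end

section \<open>Free vector spaces\<close>

lemma lookup_pm_scale [simp]: "Poly_Mapping.lookup (pm_scale c f) x = c * Poly_Mapping.lookup f x"
  by (simp add: pm_scale_def Poly_Mapping.map.rep_eq when_def)

lemma pm_scale_single [simp]: "pm_scale c (Poly_Mapping.single x e) = Poly_Mapping.single x (c * e)"
  by (simp add: pm_scale_def)

lemma keys_pm_scale: "Poly_Mapping.keys (pm_scale c f) \<subseteq> Poly_Mapping.keys f"
  by (auto simp: in_keys_iff)

lemma pm_scale_simps:
  "pm_scale (c + e) f = pm_scale c f + pm_scale e f"
  "pm_scale c (f + g) = pm_scale c f + pm_scale c g"
  "pm_scale (c * e) f = pm_scale c (pm_scale e f)"
  "pm_scale 1 f = f"
  by (auto intro!: poly_mapping_eqI simp: lookup_add algebra_simps)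

lemma free_module_simps [simp]:
  "carrier (free_module Y) = {f. Poly_Mapping.keys f \<subseteq> Y}"
  "add (free_module Y) = (+)" "ring.zero (free_module Y) = 0" "module.smult (free_module Y) = pm_scale"
  by (simp_all add: free_module_def)

lemma free_module_module: "module ground (free_module Y :: ('k::field, 'x \<Rightarrow>\<^sub>0 'k) module)"
proof (rule moduleI_ground)
  show "abelian_group (free_module Y :: ('k::field, 'x \<Rightarrow>\<^sub>0 'k) module)"
  proof (rule abelian_groupI)
    fix f :: "'x \<Rightarrow>\<^sub>0 'k" assume "f \<in> carrier (free_module Y)"
    then show "\<exists>g\<in>carrier (free_module Y). g \<oplus>\<^bsub>free_module Y\<^esub> f = \<zero>\<^bsub>free_module Y\<^esub>"
      by (intro bexI[of _ "- f"]) (auto simp: in_keys_iff)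
  next
    fix f g :: "'x \<Rightarrow>\<^sub>0 'k" assume "f \<in> carrier (free_module Y)" "g \<in> carrier (free_module Y)"
    then show "f \<oplus>\<^bsub>free_module Y\<^esub> g \<in> carrier (free_module Y)"
      using Poly_Mapping.keys_add[of f g] by auto
  qed (auto simp: algebra_simps)
qed (auto simp: pm_scale_simps dest: keys_pm_scale[THEN subsetD])

text \<open>Additivity in place of the disjointness of supports makes this rule directly applicable to maps
  that are linear or bilinear.\<close>

lemma poly_mapping_single_induct [case_names zero single add]:
  assumes "P 0" and "\<And>x c. P (Poly_Mapping.single x c)" and "\<And>f g. \<lbrakk>P f; P g\<rbrakk> \<Longrightarrow> P (f + g)"
  shows "P (f :: 'x \<Rightarrow>\<^sub>0 'k::comm_monoid_add)"
proof (induction f rule: Poly_Mapping.update_induct)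
  case (update f x c)
  have "Poly_Mapping.update x c f = f + Poly_Mapping.single x c"
    using update.hyps(1)
    by (intro poly_mapping_eqI) (auto simp: lookup_update lookup_add lookup_single when_def in_keys_iff)
  with update assms show ?case by simp
qed (fact assms(1))

text \<open>The linear extension of a map on a basis. It is also the sum that \<^const>\<open>tensor_lift\<close> applies
  to each representative, so that the lift of a bilinear map is a linear extension passed to a
  quotient.\<close>

definition lin_ext :: "('k::field, 'c) module \<Rightarrow> ('x \<Rightarrow> 'c) \<Rightarrow> ('x \<Rightarrow>\<^sub>0 'k) \<Rightarrow> 'c" where
  "lin_ext P h f = (\<Oplus>\<^bsub>P\<^esub>x\<in>Poly_Mapping.keys f. Poly_Mapping.lookup f x \<odot>\<^bsub>P\<^esub> h x)"

text \<open>Supports shrink under cancellation; two linear combinations become comparable once both are summed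
  over a common finite set.\<close>

lemma lin_ext_superset:
  fixes P :: "('k::field, 'c) module" and Y :: "'x set"
  assumes P: "module ground P" and h: "h \<in> Y \<rightarrow> carrier P"
    and A: "finite A" "Poly_Mapping.keys f \<subseteq> A" "A \<subseteq> Y"
  shows "lin_ext P h f = (\<Oplus>\<^bsub>P\<^esub>x\<in>A. Poly_Mapping.lookup f x \<odot>\<^bsub>P\<^esub> h x)"
proof -
  interpret P: module ground P by fact
  have hP: "h x \<in> carrier P" if "x \<in> A" for x using that A h by auto
  show ?thesis
    unfolding lin_ext_def
    by (rule P.add.finprod_mono_neutral_cong_left)
      (use A hP in \<open>auto simp: in_keys_iff module_groundD[OF P]\<close>)
qed

lemma lin_ext_linear:
  fixes P :: "('k::field, 'c) module" and Y :: "'x set"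
  assumes P: "module ground P" and h: "h \<in> Y \<rightarrow> carrier P"
  shows "linear_map (free_module Y) P (lin_ext P h)"
proof (rule linear_mapI)
  interpret P: module ground P by fact
  note ext = lin_ext_superset[OF P h]
  have hP: "h x \<in> carrier P" if "x \<in> Y" for x using that h by auto
  note mod = module_groundD[OF P hP]
  fix f :: "'x \<Rightarrow>\<^sub>0 'k" assume f: "f \<in> carrier (free_module Y)"
  then have fY: "Poly_Mapping.keys f \<subseteq> Y" by simp
  then show "lin_ext P h f \<in> carrier P"
    unfolding lin_ext_def by (intro P.finsum_closed) (auto simp: mod)
  show "lin_ext P h (c \<odot>\<^bsub>free_module Y\<^esub> f) = c \<odot>\<^bsub>P\<^esub> lin_ext P h f" for c
  proof -
    have "lin_ext P h (pm_scale c f)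
        = (\<Oplus>\<^bsub>P\<^esub>x\<in>Poly_Mapping.keys f. Poly_Mapping.lookup (pm_scale c f) x \<odot>\<^bsub>P\<^esub> h x)"
      using fY by (intro ext) (auto dest: keys_pm_scale[THEN subsetD])
    also have "\<dots> = (\<Oplus>\<^bsub>P\<^esub>x\<in>Poly_Mapping.keys f. c \<odot>\<^bsub>P\<^esub> (Poly_Mapping.lookup f x \<odot>\<^bsub>P\<^esub> h x))"
      using fY by (intro P.finsum_cong') (auto simp: mod module_groundD[OF P])
    also have "\<dots> = c \<odot>\<^bsub>P\<^esub> lin_ext P h f"
      unfolding lin_ext_def using fY
      by (intro P.finsum_smult_ldistr[symmetric]) (auto simp: mod ground_simps)
    finally show ?thesis by simp
  qed
  fix g :: "'x \<Rightarrow>\<^sub>0 'k" assume g: "g \<in> carrier (free_module Y)"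
  let ?A = "Poly_Mapping.keys f \<union> Poly_Mapping.keys g"
  have A: "?A \<subseteq> Y" using f g by auto
  have "lin_ext P h (f + g) = (\<Oplus>\<^bsub>P\<^esub>x\<in>?A. Poly_Mapping.lookup (f + g) x \<odot>\<^bsub>P\<^esub> h x)"
    using A Poly_Mapping.keys_add[of f g] by (intro ext) auto
  also have "\<dots> = (\<Oplus>\<^bsub>P\<^esub>x\<in>?A. Poly_Mapping.lookup f x \<odot>\<^bsub>P\<^esub> h x \<oplus>\<^bsub>P\<^esub> Poly_Mapping.lookup g x \<odot>\<^bsub>P\<^esub> h x)"
    using A by (intro P.finsum_cong') (auto simp: mod lookup_add)
  also have "\<dots> = (\<Oplus>\<^bsub>P\<^esub>x\<in>?A. Poly_Mapping.lookup f x \<odot>\<^bsub>P\<^esub> h x) \<oplus>\<^bsub>P\<^esub> (\<Oplus>\<^bsub>P\<^esub>x\<in>?A. Poly_Mapping.lookup g x \<odot>\<^bsub>P\<^esub> h x)"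
    using A by (intro P.finsum_addf) (auto simp: mod)
  also have "\<dots> = lin_ext P h f \<oplus>\<^bsub>P\<^esub> lin_ext P h g"
    using A ext[of ?A f] ext[of ?A g] by simp
  finally show "lin_ext P h (f \<oplus>\<^bsub>free_module Y\<^esub> g) = lin_ext P h f \<oplus>\<^bsub>P\<^esub> lin_ext P h g" by simp
qed

lemma lin_ext_single:
  fixes P :: "('k::field, 'c) module"
  assumes P: "module ground P" and h: "h x \<in> carrier P"
  shows "lin_ext P h (Poly_Mapping.single x c) = c \<odot>\<^bsub>P\<^esub> h x"
proof -
  interpret P: module ground P by fact
  have "lin_ext P h (Poly_Mapping.single x c)
      = (\<Oplus>\<^bsub>P\<^esub>z\<in>{x}. Poly_Mapping.lookup (Poly_Mapping.single x c) z \<odot>\<^bsub>P\<^esub> h z)"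
    using h by (intro lin_ext_superset[OF P, of _ "{x}"]) auto
  also have "\<dots> = c \<odot>\<^bsub>P\<^esub> h x"
    using P.finsum_insert[of "{}" x "\<lambda>z. Poly_Mapping.lookup (Poly_Mapping.single x c) z \<odot>\<^bsub>P\<^esub> h z"] h
    by (simp add: module_groundD[OF P])
  finally show ?thesis .
qed

section \<open>Tensor products\<close>

lemma free_module_minus:
  assumes "f \<in> carrier (free_module Y)" and "g \<in> carrier (free_module Y)"
  shows "f \<ominus>\<^bsub>free_module Y\<^esub> g = f - (g :: 'x \<Rightarrow>\<^sub>0 'k::field)"
proof -
  interpret F: module ground "free_module Y :: ('k, 'x \<Rightarrow>\<^sub>0 'k) module" by (rule free_module_module)
  have "\<ominus>\<^bsub>free_module Y\<^esub> g = - g"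
    using assms by (intro F.minus_equality) auto
  then show ?thesis by (simp add: a_minus_def)
qed

lemma free_module_diff_closed:
  fixes f g :: "'x \<Rightarrow>\<^sub>0 'k::field"
  assumes "f \<in> carrier (free_module Y)" and "g \<in> carrier (free_module Y)"
  shows "f - g \<in> carrier (free_module Y)"
proof -
  interpret F: module ground "free_module Y :: ('k, 'x \<Rightarrow>\<^sub>0 'k) module" by (rule free_module_module)
  show ?thesis using F.minus_closed[OF assms] free_module_minus[OF assms] by metis
qed

lemma linear_map_free_diff:
  fixes P :: "('k::field, 'c) module"
  assumes P: "module ground P" and h: "linear_map (free_module Y) P h"
    and f: "f \<in> carrier (free_module Y)" and g: "g \<in> carrier (free_module Y)"
  shows "h (f - g) = h f \<ominus>\<^bsub>P\<^esub> h g"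
proof -
  interpret P: module ground P by fact
  note fg = free_module_diff_closed[OF f g]
  have "h (f - g) \<oplus>\<^bsub>P\<^esub> h g = h f"
    using linear_mapD(2)[OF h fg g] by simp
  then show ?thesis
    unfolding a_minus_def
    using P.add.inv_solve_right[of "h (f - g)" "h f" "h g"] linear_mapD(1)[OF h] f g fg by simp
qed

definition bilinear_map ::
    "('k::field, 'a) module \<Rightarrow> ('k, 'b) module \<Rightarrow> ('k, 'c) module \<Rightarrow> ('a \<Rightarrow> 'b \<Rightarrow> 'c) \<Rightarrow> bool" where
  "bilinear_map M N P \<beta> \<longleftrightarrow>
     (\<forall>x\<in>carrier M. linear_map N P (\<beta> x)) \<and> (\<forall>y\<in>carrier N. linear_map M P (\<lambda>x. \<beta> x y))"

lemma bilinear_map_compose: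
  assumes "bilinear_map M N P \<beta>" "linear_map M' M f" "linear_map N' N g"
  shows "bilinear_map M' N' P (\<lambda>x y. \<beta> (f x) (g y))"
  using assms by (auto simp: bilinear_map_def linear_map_def Pi_iff)

context
  fixes M :: "('k::field, 'a) module" and N :: "('k, 'b) module"
  assumes M: "module ground M" and N: "module ground N"
begin

interpretation M: module ground M by (fact M)
interpretation N: module ground N by (fact N)

private abbreviation (input) "F \<equiv> free_module (carrier M \<times> carrier N) :: ('k, ('a \<times> 'b) \<Rightarrow>\<^sub>0 'k) module"

lemma single_mem: "\<lbrakk>x \<in> carrier M; y \<in> carrier N\<rbrakk> \<Longrightarrow> Poly_Mapping.single (x, y) c \<in> carrier F"
  by simp

lemma tensor_relators_subset: "tensor_relators M N \<subseteq> carrier F"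
  unfolding tensor_relators_def
  by (auto simp del: free_module_simps
      intro!: free_module_diff_closed single_mem module_groundD(1)[OF M] module_groundD(1)[OF N])

lemma tensor_subspace: "subspace F (tensor_null M N)"
  unfolding tensor_null_def
  by (intro subspace.intro free_module_module lin_span_submodule tensor_relators_subset)

lemma tensor_module: "module ground (tensor M N)"
  unfolding tensor_def by (rule subspace.quot_module_module[OF tensor_subspace])

lemma relator_in_null: "f \<in> tensor_relators M N \<Longrightarrow> f \<in> tensor_null M N"
  unfolding tensor_null_def using lin_span_superset[of "tensor_relators M N"] by blast

lemma coset_eq_of_relator:
  assumes "f - g \<in> tensor_relators M N" "f \<in> carrier F" "g \<in> carrier F"
  shows "tensor_null M N +>\<^bsub>F\<^esub> f = tensor_null M N +>\<^bsub>F\<^esub> g"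
  using subspace.coset_eqI[OF tensor_subspace assms(3,2)] free_module_minus[OF assms(2,3)]
    relator_in_null[OF assms(1)] by simp

lemma pure_tensor_closed:
  "\<lbrakk>x \<in> carrier M; y \<in> carrier N\<rbrakk> \<Longrightarrow> pure_tensor M N x y \<in> carrier (tensor M N)"
  unfolding pure_tensor_def tensor_def
  by (intro subspace.coset_in_carrier[OF tensor_subspace] single_mem)

text \<open>Each of the four families of relators says that two basis elements, or combinations of them, have
  the same coset, which is one of the four laws of bilinearity.\<close>

lemma pure_tensor_bilinear: "bilinear_map M N (tensor M N) (pure_tensor M N)"
proof -
  let ?s = "\<lambda>x y c. Poly_Mapping.single (x, y) c :: ('a \<times> 'b) \<Rightarrow>\<^sub>0 'k"
  let ?K = "\<lambda>f. tensor_null M N +>\<^bsub>F\<^esub> f"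
  note add = subspace.add_coset[OF tensor_subspace] and smult = subspace.smult_coset[OF tensor_subspace]
  note coset = coset_eq_of_relator
  note closed = module_groundD(1)[OF M] module_groundD(1)[OF N]
  have plus_closed: "f + g \<in> carrier F" if "f \<in> carrier F" "g \<in> carrier F" for f g
    using that Poly_Mapping.keys_add[of f g] by auto
  have scal: "?K (?s x y c) = c \<odot>\<^bsub>tensor M N\<^esub> pure_tensor M N x y"
    if "x \<in> carrier M" "y \<in> carrier N" for x y c
    using smult[of "?s x y 1" c] that by (simp add: pure_tensor_def tensor_def)
  have sum: "?K (f + g) = ?K f \<oplus>\<^bsub>tensor M N\<^esub> ?K g" if "f \<in> carrier F" "g \<in> carrier F" for f g
    using add[OF that] by (simp add: tensor_def)
  show ?thesis
    unfolding bilinear_map_def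
  proof (intro conjI ballI)
    fix x assume x: "x \<in> carrier M"
    show "linear_map N (tensor M N) (pure_tensor M N x)"
    proof (rule linear_mapI)
      fix y assume y: "y \<in> carrier N"
      show "pure_tensor M N x y \<in> carrier (tensor M N)" using x y by (rule pure_tensor_closed)
      show "pure_tensor M N x (c \<odot>\<^bsub>N\<^esub> y) = c \<odot>\<^bsub>tensor M N\<^esub> pure_tensor M N x y" for c
      proof -
        have "?s x (c \<odot>\<^bsub>N\<^esub> y) 1 - ?s x y c \<in> tensor_relators M N"
          using x y by (auto simp: tensor_relators_def)
        then have "?K (?s x (c \<odot>\<^bsub>N\<^esub> y) 1) = ?K (?s x y c)"
          by (rule coset) (use x y closed in auto)
        then show ?thesis
          by (simp only: pure_tensor_def[of M N x "c \<odot>\<^bsub>N\<^esub> y"] scal[OF x y])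
      qed
      fix y' assume y': "y' \<in> carrier N"
      have "?s x (y \<oplus>\<^bsub>N\<^esub> y') 1 - (?s x y 1 + ?s x y' 1) \<in> tensor_relators M N"
        unfolding tensor_relators_def diff_diff_eq[symmetric]
        by (rule UnI1, rule UnI1, rule UnI2, rule CollectI, rule exI[of _ x], rule exI[of _ y],
            rule exI[of _ y']) (simp add: x y y')
      then have "?K (?s x (y \<oplus>\<^bsub>N\<^esub> y') 1) = ?K (?s x y 1 + ?s x y' 1)"
        by (rule coset) (intro plus_closed single_mem x y y' N.a_closed)+
      then show "pure_tensor M N x (y \<oplus>\<^bsub>N\<^esub> y') =
          pure_tensor M N x y \<oplus>\<^bsub>tensor M N\<^esub> pure_tensor M N x y'"
        using sum[OF single_mem[OF x y] single_mem[OF x y']] by (simp add: pure_tensor_def)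
    qed
  next
    fix y assume y: "y \<in> carrier N"
    show "linear_map M (tensor M N) (\<lambda>x. pure_tensor M N x y)"
    proof (rule linear_mapI)
      fix x assume x: "x \<in> carrier M"
      show "pure_tensor M N x y \<in> carrier (tensor M N)" using x y by (rule pure_tensor_closed)
      show "pure_tensor M N (c \<odot>\<^bsub>M\<^esub> x) y = c \<odot>\<^bsub>tensor M N\<^esub> pure_tensor M N x y" for c
      proof -
        have "?s (c \<odot>\<^bsub>M\<^esub> x) y 1 - ?s x y c \<in> tensor_relators M N"
          unfolding tensor_relators_def by (rule UnI1, rule UnI2, rule CollectI, rule exI[of _ c], rule exI[of _ x],
              rule exI[of _ y]) (simp add: x y)
        then have "?K (?s (c \<odot>\<^bsub>M\<^esub> x) y 1) = ?K (?s x y c)"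
          by (rule coset) (use x y closed in auto)
        then show ?thesis
          by (simp only: pure_tensor_def[of M N "c \<odot>\<^bsub>M\<^esub> x" y] scal[OF x y])
      qed
      fix x' assume x': "x' \<in> carrier M"
      have "?s (x \<oplus>\<^bsub>M\<^esub> x') y 1 - (?s x y 1 + ?s x' y 1) \<in> tensor_relators M N"
        unfolding tensor_relators_def diff_diff_eq[symmetric]
        by (rule UnI1, rule UnI1, rule UnI1, rule CollectI, rule exI[of _ x], rule exI[of _ x'],
            rule exI[of _ y]) (simp add: x y x')
      then have "?K (?s (x \<oplus>\<^bsub>M\<^esub> x') y 1) = ?K (?s x y 1 + ?s x' y 1)"
        by (rule coset) (intro plus_closed single_mem x y x' M.a_closed)+
      then show "pure_tensor M N (x \<oplus>\<^bsub>M\<^esub> x') y =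
          pure_tensor M N x y \<oplus>\<^bsub>tensor M N\<^esub> pure_tensor M N x' y"
        using sum[OF single_mem[OF x y] single_mem[OF x' y]] by (simp add: pure_tensor_def)
    qed
  qed
qed

text \<open>Universal property of the tensor product. The linear extension of \<open>\<beta>\<close> to the free vector space on
  pairs kills the relators because \<open>\<beta>\<close> is bilinear, hence it kills their span and passes to the
  quotient.\<close>

lemma tensor_lift:
  fixes P :: "('k, 'c) module"
  assumes P: "module ground P" and \<beta>: "bilinear_map M N P \<beta>"
  shows tensor_lift_linear: "linear_map (tensor M N) P (tensor_lift P \<beta>)"
    and tensor_lift_pure: "\<lbrakk>x \<in> carrier M; y \<in> carrier N\<rbrakk> \<Longrightarrow> tensor_lift P \<beta> (pure_tensor M N x y) = \<beta> x y"
proof -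
  interpret P: module ground P by fact
  let ?b = "\<lambda>p. \<beta> (fst p) (snd p)"
  let ?h = "lin_ext P ?b"
  have lift: "tensor_lift P \<beta> = (\<lambda>Y. the_elem (?h ` Y))"
    by (simp add: fun_eq_iff tensor_lift_def lin_ext_def)
  have \<beta>l: "linear_map M P (\<lambda>x. \<beta> x y)" if "y \<in> carrier N" for y
    using \<beta> that by (simp add: bilinear_map_def)
  have \<beta>r: "linear_map N P (\<beta> x)" if "x \<in> carrier M" for x
    using \<beta> that by (simp add: bilinear_map_def)
  have closed: "\<beta> x y \<in> carrier P" if "x \<in> carrier M" "y \<in> carrier N" for x y
    using linear_mapD(1)[OF \<beta>r] that .
  have h: "linear_map F P ?h"
    by (rule lin_ext_linear[OF P]) (auto simp: closed)
  have single: "?h (Poly_Mapping.single (x, y) c) = c \<odot>\<^bsub>P\<^esub> \<beta> x y"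
    if "x \<in> carrier M" "y \<in> carrier N" for x y c
    using lin_ext_single[OF P, of ?b "(x, y)"] closed that by simp
  note diff = linear_map_free_diff[OF P h]
  note cl = module_groundD(1)[OF M] module_groundD(1)[OF N] module_groundD(1)[OF P closed]
    free_module_diff_closed single_mem
  \<comment> \<open>The relators expressing additivity are mapped to sums of this shape.\<close>
  have cancel: "u \<oplus>\<^bsub>P\<^esub> v \<oplus>\<^bsub>P\<^esub> \<ominus>\<^bsub>P\<^esub> u \<oplus>\<^bsub>P\<^esub> \<ominus>\<^bsub>P\<^esub> v = \<zero>\<^bsub>P\<^esub>"
    if "u \<in> carrier P" "v \<in> carrier P" for u v
    using that P.r_neg[of "u \<oplus>\<^bsub>P\<^esub> v"] by (simp add: P.minus_add P.a_assoc)
  have rel: "?h f = \<zero>\<^bsub>P\<^esub>" if "f \<in> tensor_relators M N" for f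
    using that unfolding tensor_relators_def
    by (elim UnE CollectE exE conjE)
      (simp_all add: diff cl single linear_mapD[OF \<beta>l] linear_mapD[OF \<beta>r] closed
        module_groundD(5)[OF P] a_minus_def cancel P.r_neg
        del: free_module_simps)
  have null: "?h f = \<zero>\<^bsub>P\<^esub>" if "f \<in> tensor_null M N" for f
  proof -
    have "tensor_null M N \<subseteq> {f \<in> carrier F. ?h f = \<zero>\<^bsub>P\<^esub>}"
      unfolding tensor_null_def
      using tensor_relators_subset rel
      by (intro lin_span_minimal linear_map_kernel_submodule free_module_module P h) blast
    then show ?thesis using that by blast
  qed
  show "linear_map (tensor M N) P (tensor_lift P \<beta>)"
    unfolding lift tensor_def
    by (rule subspace.quot_lift_linear[OF tensor_subspace P h null])
  show "tensor_lift P \<beta> (pure_tensor M N x y) = \<beta> x y" if "x \<in> carrier M" "y \<in> carrier N"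
    unfolding lift pure_tensor_def
    using subspace.quot_lift_coset[OF tensor_subspace P h null single_mem[OF that, of 1]] single[OF that]
      module_groundD(5)[OF P closed[OF that]] by simp
qed

end

section \<open>Algebras\<close>

text \<open>The locale \<^locale>\<open>algebra\<close> is restricted to commutative algebras; this is its analogue for
  associative unital algebras over the ground field.\<close>

locale unital_algebra = module ground A + ring A for A :: "('k::field, 'a) module" (structure) +
  assumes smult_mult_left: "\<lbrakk>x \<in> carrier A; y \<in> carrier A\<rbrakk> \<Longrightarrow> (c \<odot> x) \<otimes> y = c \<odot> (x \<otimes> y)"
    and smult_mult_right: "\<lbrakk>x \<in> carrier A; y \<in> carrier A\<rbrakk> \<Longrightarrow> x \<otimes> (c \<odot> y) = c \<odot> (x \<otimes> y)"
begin

lemma module: "module ground A" ..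

lemma mult_bilinear: "bilinear_map A A A (\<otimes>)"
  unfolding bilinear_map_def
  by (auto intro!: linear_mapI simp: smult_mult_left smult_mult_right l_distr r_distr)

end

lemma algebra_mapD:
  assumes "algebra_map A B f"
  shows "linear_map A B f" and "f \<one>\<^bsub>A\<^esub> = \<one>\<^bsub>B\<^esub>"
    and "\<lbrakk>x \<in> carrier A; y \<in> carrier A\<rbrakk> \<Longrightarrow> f (x \<otimes>\<^bsub>A\<^esub> y) = f x \<otimes>\<^bsub>B\<^esub> f y"
  using assms by (auto simp: algebra_map_def ring_hom_def)

lemma algebra_mapI:
  assumes "linear_map A B f" and "f \<one>\<^bsub>A\<^esub> = \<one>\<^bsub>B\<^esub>"
    and "\<And>x y. \<lbrakk>x \<in> carrier A; y \<in> carrier A\<rbrakk> \<Longrightarrow> f (x \<otimes>\<^bsub>A\<^esub> y) = f x \<otimes>\<^bsub>B\<^esub> f y"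
  shows "algebra_map A B f"
  using assms by (auto simp: algebra_map_def ring_hom_def linear_map_def)

text \<open>Composed with a coproduct, the map \<open>m (f \<otimes> g)\<close> is the convolution of \<open>f\<close> and \<open>g\<close>. It is
  available when \<open>f\<close> and \<open>g\<close> are defined on a mere vector space \<open>V\<close>, such as the span of the generators.\<close>

lemma product_map_tensor_map:
  fixes A :: "('k::field, 'a) module" and V :: "('k, 'v) module"
  assumes A: "unital_algebra A" and V: "module ground V"
    and f: "linear_map V A f" and g: "linear_map V A g"
  shows product_map_tensor_map_linear:
      "linear_map (tensor V V) A (\<lambda>t. product_map A (tensor_map A A f g t))"
    and product_map_tensor_map_pure:
      "\<lbrakk>x \<in> carrier V; y \<in> carrier V\<rbrakk> \<Longrightarrow>
        product_map A (tensor_map A A f g (pure_tensor V V x y)) = f x \<otimes>\<^bsub>A\<^esub> g y"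
proof -
  interpret A: unital_algebra A by fact
  have bil: "bilinear_map V V (tensor A A) (\<lambda>x y. pure_tensor A A (f x) (g y))"
    by (rule bilinear_map_compose[OF pure_tensor_bilinear f g]) (rule A.module)+
  note tm = tensor_module[OF A.module A.module]
  note pm = tensor_lift_linear[OF A.module A.module A.module A.mult_bilinear]
    tensor_lift_pure[OF A.module A.module A.module A.mult_bilinear]
  show "linear_map (tensor V V) A (\<lambda>t. product_map A (tensor_map A A f g t))"
    unfolding product_map_def tensor_map_def
    by (rule linear_map_compose[OF tensor_lift_linear[OF V V tm bil] pm(1)])
  show "product_map A (tensor_map A A f g (pure_tensor V V x y)) = f x \<otimes>\<^bsub>A\<^esub> g y"
    if "x \<in> carrier V" "y \<in> carrier V"
    unfolding product_map_def tensor_map_def tensor_lift_pure[OF V V tm bil that]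
    using linear_mapD(1)[OF f] linear_mapD(1)[OF g] that by (simp add: pm(2))
qed

text \<open>An ideal of a unital algebra is automatically a subspace, since scalars act as multiplication by
  multiples of the unit. The quotient by it is therefore both a vector space and a ring.\<close>

lemma quotient_algebra:
  fixes A :: "('k::field, 'a) module" (structure)
  assumes A: "unital_algebra A" and I: "ideal I A"
  shows ideal_subspace: "subspace A I"
    and unital_algebra_quot_module: "unital_algebra (quot_module A I)"
    and projection_algebra_map: "algebra_map A (quot_module A I) ((+>) I)"
proof -
  interpret A: unital_algebra A by fact
  interpret I: ideal I A by fact
  have "c \<odot> x \<in> I" if "x \<in> I" for c x
  proof -
    have "c \<odot> x = (c \<odot> \<one>) \<otimes> x"
      using that by (simp add: A.smult_mult_left)
    then show ?thesis using I.I_l_closed[OF that, of "c \<odot> \<one>"] module_groundD(1)[OF A.module] by simp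
  qed
  then have "submodule I ground A"
    by (intro submodule_groundI A.module) (auto simp: I.zero_closed)
  then show sub: "subspace A I" by (intro subspace.intro A.module)
  interpret S: subspace A I by fact
  let ?Q = "quot_module A I"
  interpret Q: module ground ?Q by (rule S.quot_module_module)
  have mult: "(I +> x) \<otimes>\<^bsub>?Q\<^esub> (I +> y) = I +> (x \<otimes> y)" if "x \<in> carrier A" "y \<in> carrier A" for x y
    using that by (simp add: I.rcoset_mult_add)
  have one: "\<one>\<^bsub>?Q\<^esub> = I +> \<one>" by simp
  note [simp del] = quot_module_simps
  note [simp] = S.add_coset S.smult_coset S.coset_in_carrier mult one module_groundD(1)[OF A.module]
  have "ring ?Q"
  proof (intro ringI monoidI Q.abelian_group_axioms)
    show "\<one>\<^bsub>?Q\<^esub> \<in> carrier ?Q" by simp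
    fix U assume "U \<in> carrier ?Q"
    then obtain x where x: "x \<in> carrier A" "U = I +> x" by (rule S.carrier_cases)
    show "\<one>\<^bsub>?Q\<^esub> \<otimes>\<^bsub>?Q\<^esub> U = U" "U \<otimes>\<^bsub>?Q\<^esub> \<one>\<^bsub>?Q\<^esub> = U" using x by simp_all
    fix V assume "V \<in> carrier ?Q"
    then obtain y where y: "y \<in> carrier A" "V = I +> y" by (rule S.carrier_cases)
    show "U \<otimes>\<^bsub>?Q\<^esub> V \<in> carrier ?Q" using x y by simp
    fix W assume "W \<in> carrier ?Q"
    then obtain z where z: "z \<in> carrier A" "W = I +> z" by (rule S.carrier_cases)
    show "U \<otimes>\<^bsub>?Q\<^esub> V \<otimes>\<^bsub>?Q\<^esub> W = U \<otimes>\<^bsub>?Q\<^esub> (V \<otimes>\<^bsub>?Q\<^esub> W)"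
      "(U \<oplus>\<^bsub>?Q\<^esub> V) \<otimes>\<^bsub>?Q\<^esub> W = U \<otimes>\<^bsub>?Q\<^esub> W \<oplus>\<^bsub>?Q\<^esub> V \<otimes>\<^bsub>?Q\<^esub> W"
      "W \<otimes>\<^bsub>?Q\<^esub> (U \<oplus>\<^bsub>?Q\<^esub> V) = W \<otimes>\<^bsub>?Q\<^esub> U \<oplus>\<^bsub>?Q\<^esub> W \<otimes>\<^bsub>?Q\<^esub> V"
      using x y z by (simp_all add: A.m_assoc A.l_distr A.r_distr)
  qed
  then interpret QR: ring ?Q .
  show "unital_algebra ?Q"
  proof (intro unital_algebra.intro Q.module_axioms QR.ring_axioms unital_algebra_axioms.intro)
    fix U V c assume "U \<in> carrier ?Q" "V \<in> carrier ?Q"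
    then obtain x y where xy: "x \<in> carrier A" "U = I +> x" "y \<in> carrier A" "V = I +> y"
      by (metis S.carrier_cases)
    then show "(c \<odot>\<^bsub>?Q\<^esub> U) \<otimes>\<^bsub>?Q\<^esub> V = c \<odot>\<^bsub>?Q\<^esub> (U \<otimes>\<^bsub>?Q\<^esub> V)"
        "U \<otimes>\<^bsub>?Q\<^esub> (c \<odot>\<^bsub>?Q\<^esub> V) = c \<odot>\<^bsub>?Q\<^esub> (U \<otimes>\<^bsub>?Q\<^esub> V)"
      by (simp_all add: A.smult_mult_left A.smult_mult_right)
  qed
  show "algebra_map A ?Q ((+>) I)"
    by (rule algebra_mapI) (simp_all add: S.projection_linear)
qed

lemma algebra_map_kernel_ideal:
  assumes A: "unital_algebra A" and B: "unital_algebra B" and f: "algebra_map A B f"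
  shows "ideal {x \<in> carrier A. f x = \<zero>\<^bsub>B\<^esub>} A"
proof -
  interpret A: unital_algebra A by fact
  interpret B: unital_algebra B by fact
  note f' = algebra_mapD[OF f] and closed = linear_mapD(1)[OF algebra_mapD(1)[OF f]]
  have "submodule {x \<in> carrier A. f x = \<zero>\<^bsub>B\<^esub>} ground A"
    by (rule linear_map_kernel_submodule[OF A.module B.module f'(1)])
  then show ?thesis
    by (intro idealI A.ring_axioms) (auto simp: submodule_def f'(3) closed)
qed

lemma algebra_map_factor:
  assumes A: "unital_algebra A" and I: "ideal I A" and B: "unital_algebra B"
    and f: "algebra_map A B f" and null: "\<And>x. x \<in> I \<Longrightarrow> f x = \<zero>\<^bsub>B\<^esub>"
  shows "\<exists>\<phi>. algebra_map (quot_module A I) B \<phi> \<and> (\<forall>x\<in>carrier A. \<phi> (I +>\<^bsub>A\<^esub> x) = f x)"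
proof -
  interpret A: unital_algebra A by fact
  interpret B: unital_algebra B by fact
  interpret I: ideal I A by fact
  interpret S: subspace A I by (rule ideal_subspace[OF A I])
  note f' = algebra_mapD[OF f]
  let ?\<phi> = "\<lambda>V. the_elem (f ` V)"
  note lift = S.quot_lift_coset[OF B.module f'(1) null]
  have "algebra_map (quot_module A I) B ?\<phi>"
  proof (rule algebra_mapI)
    show "linear_map (quot_module A I) B ?\<phi>"
      by (rule S.quot_lift_linear[OF B.module f'(1) null])
    show "?\<phi> \<one>\<^bsub>quot_module A I\<^esub> = \<one>\<^bsub>B\<^esub>" by (simp add: lift f'(2))
    fix U V assume "U \<in> carrier (quot_module A I)" "V \<in> carrier (quot_module A I)"
    then obtain x y where "x \<in> carrier A" "U = I +>\<^bsub>A\<^esub> x" "y \<in> carrier A" "V = I +>\<^bsub>A\<^esub> y"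
      by (metis S.carrier_cases)
    then show "?\<phi> (U \<otimes>\<^bsub>quot_module A I\<^esub> V) = ?\<phi> U \<otimes>\<^bsub>B\<^esub> ?\<phi> V"
      by (simp add: I.rcoset_mult_add lift f'(3))
  qed
  then show ?thesis using lift by blast
qed

section \<open>The free algebra\<close>

lemma free_algebra_simps [simp]:
  "carrier free_algebra = UNIV" "monoid.mult free_algebra = (*)" "monoid.one free_algebra = 1"
  "add free_algebra = (+)" "ring.zero free_algebra = 0" "module.smult free_algebra = pm_scale"
  by (simp_all add: free_algebra_def)

text \<open>Scaling is multiplication by a multiple of the empty word, and these multiples are central.\<close>

lemma pm_scale_mult:
  fixes f g :: "'x::monoid_add \<Rightarrow>\<^sub>0 'k::field"
  shows "pm_scale c f * g = pm_scale c (f * g)" and "f * pm_scale c g = pm_scale c (f * g)"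
proof -
  have scale: "pm_scale c h = Poly_Mapping.single 0 c * h" for h :: "'x \<Rightarrow>\<^sub>0 'k"
    by (simp add: pm_scale_def mult_map_scale_conv_mult)
  show "pm_scale c f * g = pm_scale c (f * g)" by (simp add: scale mult.assoc)
  have "Poly_Mapping.single 0 c * f = f * Poly_Mapping.single 0 c"
    by (induction f rule: poly_mapping_single_induct) (simp_all add: mult_single algebra_simps)
  then show "f * pm_scale c g = pm_scale c (f * g)" by (simp add: scale mult.assoc[symmetric])
qed

lemma free_algebra_unital: "unital_algebra (free_algebra :: ('k::field, 'x word \<Rightarrow>\<^sub>0 'k) module)"
proof -
  let ?F = "free_algebra :: ('k::field, 'x word \<Rightarrow>\<^sub>0 'k) module"
  have grp: "abelian_group ?F"
    by (rule abelian_groupI) (auto simp: algebra_simps intro: exI[of _ "- _"])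
  have mod: "module ground ?F"
    by (rule moduleI_ground[OF grp]) (simp_all add: pm_scale_simps)
  have ring: "ring ?F"
    by (rule ringI[OF grp]) (auto intro!: monoidI simp: algebra_simps)
  interpret module ground ?F by fact
  interpret ring ?F by fact
  show ?thesis
    by unfold_locales (simp_all add: pm_scale_mult)
qed

fun word_eval :: "('k, 'b) module \<Rightarrow> ('x \<Rightarrow> 'b) \<Rightarrow> 'x word \<Rightarrow> 'b" where
  "word_eval B g (Word xs) = foldr (\<lambda>x r. g x \<otimes>\<^bsub>B\<^esub> r) xs \<one>\<^bsub>B\<^esub>"

text \<open>Universal property of the free algebra: evaluate words as products and extend linearly. On basis
  words the extension is multiplicative because concatenation evaluates to the product; two inductions
  over linear combinations then give multiplicativity.\<close>

lemma free_algebra_universal: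
  fixes B :: "('k::field, 'b) module" (structure) and g :: "'x \<Rightarrow> 'b"
  assumes B: "unital_algebra B" and g: "\<And>x. g x \<in> carrier B"
  shows "\<exists>f. algebra_map free_algebra B f \<and> (\<forall>x. f (free_gen x) = g x)"
proof -
  interpret B: unital_algebra B by fact
  let ?w = "word_eval B g" and ?f = "lin_ext B (word_eval B g)"
  have w_list: "?w (Word xs) \<in> carrier B" for xs by (induction xs) (simp_all add: g)
  then have w: "?w u \<in> carrier B" for u by (cases u) simp
  have w_append: "?w (Word (xs @ ys)) = ?w (Word xs) \<otimes> ?w (Word ys)" for xs ys
    using w_list by (induction xs) (simp_all add: g B.m_assoc)
  have w_plus: "?w (u + v) = ?w u \<otimes> ?w v" for u v
    by (cases u; cases v) (simp only: plus_word.simps w_append)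
  have f_lin: "linear_map (free_module UNIV) B ?f"
    by (rule lin_ext_linear[OF B.module]) (simp add: w)
  then have f_lin': "linear_map free_algebra B ?f"
    by (simp add: linear_map_def)
  note fD = linear_mapD[OF f_lin', simplified]
  have f_zero: "?f 0 = \<zero>"
    using linear_map_zero[OF free_module_module B.module f_lin] by simp
  have f_single: "?f (Poly_Mapping.single u c) = c \<odot> ?w u" for u c
    using lin_ext_single[OF B.module, where h = ?w] w by blast
  \<comment> \<open>The left factor is a single word here; bilinearity then extends the result to all left factors.\<close>
  have f_mult_single: "?f (Poly_Mapping.single u c * h) = ?f (Poly_Mapping.single u c) \<otimes> ?f h" for u c h
  proof (induction h rule: poly_mapping_single_induct)
    case (single v e)
    then show ?case
      by (simp add: mult_single f_single w_plus w B.smult_mult_left B.smult_mult_right mult.commute[of c]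
          module_groundD(1)[OF B.module] module_groundD(4)[OF B.module, symmetric])
  qed (simp_all add: f_zero fD distrib_left B.r_distr)
  have f_mult: "?f (h * k) = ?f h \<otimes> ?f k" for h k
    by (induction h rule: poly_mapping_single_induct)
      (simp_all add: f_zero fD distrib_right B.l_distr f_mult_single)
  have "algebra_map free_algebra B ?f"
  proof (rule algebra_mapI[OF f_lin'])
    have "?f 1 = 1 \<odot> ?w 0" using f_single[of 0 1] by simp
    then show "?f \<one>\<^bsub>free_algebra\<^esub> = \<one>"
      by (simp add: zero_word_def module_groundD(5)[OF B.module])
  qed (simp add: f_mult)
  moreover have "?f (free_gen x) = g x" for x
    by (simp add: free_gen_def f_single g module_groundD(5)[OF B.module])
  ultimately show ?thesis by blast
qed

section \<open>The algebra $Sl_q(2)$\<close>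

text \<open>A family of four elements of an algebra satisfying the defining relations, that is, a \<open>B\<close>-valued
  point of the quantum group. The two relations containing \<open>ad\<close> are solved for \<open>ad\<close>.\<close>

definition sl_q_relations :: "('k::field, 'b) module \<Rightarrow> 'k \<Rightarrow> (slq_letter \<Rightarrow> 'b) \<Rightarrow> bool" where
  "sl_q_relations B q g \<longleftrightarrow>
     (\<forall>x. g x \<in> carrier B) \<and>
     g La \<otimes>\<^bsub>B\<^esub> g Lb = inverse q \<odot>\<^bsub>B\<^esub> (g Lb \<otimes>\<^bsub>B\<^esub> g La) \<and>
     g La \<otimes>\<^bsub>B\<^esub> g Lc = inverse q \<odot>\<^bsub>B\<^esub> (g Lc \<otimes>\<^bsub>B\<^esub> g La) \<and>
     g Lb \<otimes>\<^bsub>B\<^esub> g Ld = inverse q \<odot>\<^bsub>B\<^esub> (g Ld \<otimes>\<^bsub>B\<^esub> g Lb) \<and>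
     g Lc \<otimes>\<^bsub>B\<^esub> g Ld = inverse q \<odot>\<^bsub>B\<^esub> (g Ld \<otimes>\<^bsub>B\<^esub> g Lc) \<and>
     g Lb \<otimes>\<^bsub>B\<^esub> g Lc = g Lc \<otimes>\<^bsub>B\<^esub> g Lb \<and>
     g La \<otimes>\<^bsub>B\<^esub> g Ld = g Ld \<otimes>\<^bsub>B\<^esub> g La \<oplus>\<^bsub>B\<^esub> (inverse q - q) \<odot>\<^bsub>B\<^esub> (g Lb \<otimes>\<^bsub>B\<^esub> g Lc) \<and>
     g La \<otimes>\<^bsub>B\<^esub> g Ld = inverse q \<odot>\<^bsub>B\<^esub> (g Lb \<otimes>\<^bsub>B\<^esub> g Lc) \<oplus>\<^bsub>B\<^esub> \<one>\<^bsub>B\<^esub>"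

lemma slq_ideal: "ideal (slq_ideal q) free_algebra"
  unfolding slq_ideal_def
  using unital_algebra.axioms(2)[OF free_algebra_unital] by (intro ring.genideal_ideal) auto

lemma Slq_algebra: "unital_algebra (Slq q)"
  unfolding Slq_def by (rule unital_algebra_quot_module[OF free_algebra_unital slq_ideal])

lemma Slq_projection: "algebra_map free_algebra (Slq q) ((+>\<^bsub>free_algebra\<^esub>) (slq_ideal q))"
  unfolding Slq_def by (rule projection_algebra_map[OF free_algebra_unital slq_ideal])

lemma algebra_map_free_diff_zero_iff:
  fixes B :: "('k::field, 'b) module"
  assumes B: "unital_algebra B" and f: "algebra_map free_algebra B f"
  shows "f (u - v) = \<zero>\<^bsub>B\<^esub> \<longleftrightarrow> f u = f v"
proof -
  interpret B: unital_algebra B by fact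
  have lin: "linear_map (free_module UNIV) B f"
    using algebra_mapD(1)[OF f] by (simp add: linear_map_def)
  have "f u \<in> carrier B" "f v \<in> carrier B" using linear_mapD(1)[OF lin] by simp_all
  then show ?thesis
    using linear_map_free_diff[OF B.module lin, of u v] B.r_right_minus_eq by simp
qed

text \<open>Read for the projection onto the quotient, this says that the generators satisfy the relations; read
  for the evaluation at a given point, it says that the evaluation descends to the quotient.\<close>

lemma relators_vanish_iff:
  fixes B :: "('k::field, 'b) module"
  assumes B: "unital_algebra B" and f: "algebra_map free_algebra B f"
  shows "(\<forall>r\<in>slq_relators q. f r = \<zero>\<^bsub>B\<^esub>) \<longleftrightarrow> sl_q_relations B q (\<lambda>x. f (free_gen x))"
proof -
  note lin = linear_mapD[OF algebra_mapD(1)[OF f], simplified]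
  note fm = algebra_mapD(2,3)[OF f, simplified]
  show ?thesis
    unfolding slq_relators_def sl_q_relations_def Let_def diff_diff_eq
    by (simp add: algebra_map_free_diff_zero_iff[OF B f] lin fm)
qed

lemma slq_gen_relations: "sl_q_relations (Slq q) q (slq_gen q)"
proof -
  interpret I: ideal "slq_ideal q" "free_algebra :: ('a, slq_letter word \<Rightarrow>\<^sub>0 'a) module" by (rule slq_ideal)
  have "slq_relators q \<subseteq> slq_ideal q"
    unfolding slq_ideal_def by (rule I.genideal_self) simp
  then have "\<forall>r\<in>slq_relators q. slq_ideal q +>\<^bsub>free_algebra\<^esub> r = \<zero>\<^bsub>Slq q\<^esub>"
    by (auto simp: Slq_def I.a_rcos_const)
  then show ?thesis
    unfolding relators_vanish_iff[OF Slq_algebra Slq_projection] slq_gen_def .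
qed

text \<open>The kernel of the evaluation of words at \<open>g\<close> is an ideal that contains the relators, hence the
  ideal they generate. This is applied twice: to the algebra itself, to extend the antipode, and to
  triangular matrices, to see that the generators are independent.\<close>

lemma Slq_universal:
  fixes B :: "('k::field, 'b) module"
  assumes B: "unital_algebra B" and g: "sl_q_relations B q g"
  shows "\<exists>\<phi>. algebra_map (Slq q) B \<phi> \<and> (\<forall>x. \<phi> (slq_gen q x) = g x)"
proof -
  interpret F: ring "free_algebra :: ('k, slq_letter word \<Rightarrow>\<^sub>0 'k) module"
    using unital_algebra.axioms(2)[OF free_algebra_unital] .
  obtain f where f: "algebra_map free_algebra B f" and f_gen: "\<And>x. f (free_gen x) = g x"
    using free_algebra_universal[OF B, of g] g by (auto simp: sl_q_relations_def)
  have "slq_relators q \<subseteq> {u \<in> carrier free_algebra. f u = \<zero>\<^bsub>B\<^esub>}"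
    using relators_vanish_iff[OF B f, of q] g by (auto simp: f_gen)
  then have "slq_ideal q \<subseteq> {u \<in> carrier free_algebra. f u = \<zero>\<^bsub>B\<^esub>}"
    unfolding slq_ideal_def
    by (intro F.genideal_minimal algebra_map_kernel_ideal free_algebra_unital B f)
  then have "\<And>u. u \<in> slq_ideal q \<Longrightarrow> f u = \<zero>\<^bsub>B\<^esub>" by blast
  from algebra_map_factor[OF free_algebra_unital slq_ideal B f this]
  obtain \<phi> where "algebra_map (Slq q) B \<phi>" and "\<And>u. \<phi> (slq_ideal q +>\<^bsub>free_algebra\<^esub> u) = f u"
    by (auto simp: Slq_def)
  then show ?thesis by (auto simp: slq_gen_def f_gen)
qed

section \<open>Linear independence of the generators\<close>

text \<open>The triple \<open>(x, y, z)\<close> is the matrix with rows \<open>(x, y)\<close> and \<open>(0, z)\<close>.\<close>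

definition upper_triangular :: "('k::field, 'k \<times> 'k \<times> 'k) module" where
  "upper_triangular =
     \<lparr>carrier = UNIV, monoid.mult = (\<lambda>(x, y, z) (x', y', z'). (x * x', x * y' + y * z', z * z')),
      one = (1, 0, 1), ring.zero = (0, 0, 0),
      add = (\<lambda>(x, y, z) (x', y', z'). (x + x', y + y', z + z')),
      module.smult = (\<lambda>c (x, y, z). (c * x, c * y, c * z))\<rparr>"

lemma upper_triangular_algebra: "unital_algebra (upper_triangular :: ('k::field, 'k \<times> 'k \<times> 'k) module)"
proof -
  let ?T = "upper_triangular :: ('k::field, 'k \<times> 'k \<times> 'k) module"
  have grp: "abelian_group ?T"
  proof (rule abelian_groupI)
    fix t :: "'k \<times> 'k \<times> 'k"
    show "\<exists>u\<in>carrier ?T. u \<oplus>\<^bsub>?T\<^esub> t = \<zero>\<^bsub>?T\<^esub>"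
      by (intro bexI[of _ "(- fst t, - fst (snd t), - snd (snd t))"])
        (auto simp: upper_triangular_def split: prod.split)
  qed (auto simp: upper_triangular_def)
  have mod: "module ground ?T"
    by (rule moduleI_ground[OF grp]) (auto simp: upper_triangular_def algebra_simps)
  have ring: "ring ?T"
    by (rule ringI[OF grp]) (auto intro!: monoidI simp: upper_triangular_def algebra_simps)
  interpret module ground ?T by fact
  interpret ring ?T by fact
  show ?thesis
    by unfold_locales (auto simp: upper_triangular_def algebra_simps)
qed

lemma ground_module_module: "module ground (ground_module :: ('k::field, 'k) module)"
  by (rule moduleI_ground, rule abelian_groupI)
    (auto simp: ground_module_def algebra_simps intro: exI[of _ "- _"])

text \<open>The first row of a triangular representation provides two linear functionals.\<close>

lemma Slq_triangular_representation:
  fixes q :: "'k::field"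
  assumes "sl_q_relations upper_triangular q g"
  shows "\<exists>e\<^sub>1 e\<^sub>2. linear_map (Slq q) ground_module e\<^sub>1 \<and> linear_map (Slq q) ground_module e\<^sub>2 \<and>
    (\<forall>i. e\<^sub>1 (slq_gen q i) = fst (g i)) \<and> (\<forall>i. e\<^sub>2 (slq_gen q i) = fst (snd (g i)))"
proof -
  obtain \<rho> where \<rho>: "algebra_map (Slq q) upper_triangular \<rho>" "\<And>i. \<rho> (slq_gen q i) = g i"
    using Slq_universal[OF upper_triangular_algebra assms] by blast
  have proj: "linear_map upper_triangular (ground_module :: ('k, 'k) module) fst"
    "linear_map upper_triangular (ground_module :: ('k, 'k) module) (\<lambda>t. fst (snd t))"
    by (auto intro!: linear_mapI simp: upper_triangular_def ground_module_def)
  show ?thesis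
    using proj[THEN linear_map_compose[OF algebra_mapD(1)[OF \<rho>(1)]]]
    by (intro exI[of _ "\<lambda>x. fst (\<rho> x)"] exI[of _ "\<lambda>x. fst (snd (\<rho> x))"]) (simp add: \<rho>(2))
qed

lemma linear_map_add:
  assumes N: "module ground N" and f: "linear_map M N f" and g: "linear_map M N g"
  shows "linear_map M N (\<lambda>x. f x \<oplus>\<^bsub>N\<^esub> g x)"
proof -
  interpret N: module ground N by fact
  show ?thesis
    by (rule linear_mapI)
      (simp_all add: linear_mapD[OF f] linear_mapD[OF g] N.a_ac module_groundD(3)[OF N])
qed

lemma linear_map_smult_vector:
  assumes N: "module ground N" and e: "linear_map M ground_module e" and n: "n \<in> carrier N"
  shows "linear_map M N (\<lambda>x. e x \<odot>\<^bsub>N\<^esub> n)"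
  by (rule linear_mapI)
    (simp_all add: linear_mapD[OF e] ground_module_def module_groundD[OF N n])

text \<open>The functionals are entries of triangular representations. For \<open>b\<close> and \<open>c\<close>: conjugation by
  \<open>a = diag(1, q)\<close> multiplies the off-diagonal matrix unit by \<open>q\<close> or its inverse, as the relations demand, and the
  unit has square zero, so that \<open>bc = 0\<close> and \<open>d\<close> can be the inverse of \<open>a\<close>. For \<open>a\<close> and \<open>d\<close>: with
  \<open>b = c = 0\<close> the only remaining relation is that \<open>d\<close> is inverse to \<open>a\<close>, and a unipotent \<open>a\<close> is told
  apart from its inverse by the off-diagonal entry when \<open>2 \<noteq> 0\<close>.\<close>

lemma Slq_dual_functional:
  fixes q :: "'k::field"
  assumes q: "q \<noteq> 0" and two: "(2::'k) \<noteq> 0"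
  shows "\<exists>e. linear_map (Slq q) ground_module e \<and> (\<forall>j. e (slq_gen q j) = (if j = i then 1 else 0))"
proof -
  note G = ground_module_module
  have scale: "linear_map ground_module ground_module ((*) c)" for c :: 'k
    by (rule linear_mapI) (simp_all add: ground_module_def algebra_simps)
  let ?bc = "\<lambda>\<beta> \<gamma> i. case i of La \<Rightarrow> (1 :: 'k, 0 :: 'k, q) | Lb \<Rightarrow> (0, \<beta>, 0) | Lc \<Rightarrow> (0, \<gamma>, 0) | Ld \<Rightarrow> (1, 0, inverse q)"
  have bc: "sl_q_relations upper_triangular q (?bc \<beta> \<gamma>)" for \<beta> \<gamma>
    using q by (simp add: sl_q_relations_def upper_triangular_def)
  let ?ad = "\<lambda>i. case i of La \<Rightarrow> (1 :: 'k, 1 :: 'k, 1 :: 'k) | Lb \<Rightarrow> (0, 0, 0) | Lc \<Rightarrow> (0, 0, 0) | Ld \<Rightarrow> (1, - 1, 1)"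
  have ad: "sl_q_relations upper_triangular q ?ad"
    by (simp add: sl_q_relations_def upper_triangular_def)
  obtain e\<^sub>1 e\<^sub>2 where XY: "linear_map (Slq q) ground_module e\<^sub>1" "linear_map (Slq q) ground_module e\<^sub>2"
    "\<forall>i. e\<^sub>1 (slq_gen q i) = fst (?ad i)" "\<forall>i. e\<^sub>2 (slq_gen q i) = fst (snd (?ad i))"
    using Slq_triangular_representation[OF ad] by (elim exE conjE) (rule that)
  have comb: "linear_map (Slq q) ground_module (\<lambda>x. c * e\<^sub>1 x + c' * e\<^sub>2 x)" for c c'
    using linear_map_add[OF G linear_map_compose[OF XY(1) scale] linear_map_compose[OF XY(2) scale]]
    by (simp add: ground_module_def)
  show ?thesis
  proof (cases i)
    case La
    then show ?thesis
      using comb[of "inverse 2" "inverse 2"] two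
      by (intro exI[of _ "\<lambda>x. inverse 2 * e\<^sub>1 x + inverse 2 * e\<^sub>2 x"] conjI) (auto simp: XY split: slq_letter.split)
  next
    case Ld
    then show ?thesis
      using comb[of "inverse 2" "- inverse 2"] two
      by (intro exI[of _ "\<lambda>x. inverse 2 * e\<^sub>1 x + - inverse 2 * e\<^sub>2 x"] conjI) (auto simp: XY split: slq_letter.split)
  next
    case Lb
    obtain h where "linear_map (Slq q) ground_module h" "\<forall>i. h (slq_gen q i) = fst (snd (?bc 1 0 i))"
      using Slq_triangular_representation[OF bc[of 1 0]] by (elim exE conjE) (rule that)
    then show ?thesis using Lb by (intro exI[of _ h] conjI) (auto split: slq_letter.split)
  next
    case Lc
    obtain h where "linear_map (Slq q) ground_module h" "\<forall>i. h (slq_gen q i) = fst (snd (?bc 0 1 i))"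
      using Slq_triangular_representation[OF bc[of 0 1]] by (elim exE conjE) (rule that)
    then show ?thesis using Lc by (intro exI[of _ h] conjI) (auto split: slq_letter.split)
  qed
qed

lemma slq_gen_closed: "slq_gen q i \<in> carrier (Slq q)"
  using slq_gen_relations[of q] by (simp add: sl_q_relations_def)

lemma slq_gen_span_range: "slq_gen_span q = span_module (Slq q) (range (slq_gen q))"
proof -
  have UNIV: "UNIV = {La, Lb, Lc, Ld}" using slq_letter.exhaust by auto
  show ?thesis unfolding slq_gen_span_def UNIV by simp
qed

lemma slq_gen_in_span: "slq_gen q i \<in> carrier (slq_gen_span q)"
  using lin_span_superset[of "range (slq_gen q)" "Slq q"] by (auto simp: slq_gen_span_range)

lemma range_slq_gen_closed: "range (slq_gen q) \<subseteq> carrier (Slq q)"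
  using slq_gen_closed by blast

lemma slq_gen_span_module: "module ground (slq_gen_span q)"
  unfolding slq_gen_span_range
  by (intro span_module_module unital_algebra.module Slq_algebra range_slq_gen_closed)

lemma linear_map_slq_gen_span:
  "linear_map (Slq q) N f \<Longrightarrow> linear_map (slq_gen_span q) N f"
  unfolding slq_gen_span_range
  by (intro linear_map_restrict_span unital_algebra.module Slq_algebra range_slq_gen_closed)

lemma linear_map_eq_on_slq_gen_span:
  assumes "module ground N" "linear_map (slq_gen_span q) N f" "linear_map (slq_gen_span q) N g"
    and "\<And>i. f (slq_gen q i) = g (slq_gen q i)" and "x \<in> carrier (slq_gen_span q)"
  shows "f x = g x"
  by (rule linear_map_eq_on_span[OF unital_algebra.module[OF Slq_algebra] range_slq_gen_closed assms(1)])
    (use assms in \<open>auto simp: slq_gen_span_range\<close>)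

text \<open>With the dual functionals \<open>e i\<close>, the map sending \<open>x\<close> to the sum of the vectors \<open>e i x \<odot> n i\<close> has the
  prescribed values.\<close>

lemma linear_map_from_slq_gen_span:
  fixes q :: "'k::field"
  assumes q: "q \<noteq> 0" and two: "(2::'k) \<noteq> 0" and N: "module ground N" and n: "\<And>i. n i \<in> carrier N"
  shows "\<exists>f. linear_map (slq_gen_span q) N f \<and> (\<forall>i. f (slq_gen q i) = n i)"
proof -
  interpret N: module ground N by fact
  obtain e where e: "\<And>i. linear_map (Slq q) ground_module (e i)"
    "\<And>i j. e i (slq_gen q j) = (if j = i then 1 else 0)"
    using Slq_dual_functional[OF q two] by metis
  let ?t = "\<lambda>i x. e i x \<odot>\<^bsub>N\<^esub> n i"
  let ?f = "\<lambda>x. ?t La x \<oplus>\<^bsub>N\<^esub> (?t Lb x \<oplus>\<^bsub>N\<^esub> (?t Lc x \<oplus>\<^bsub>N\<^esub> ?t Ld x))"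
  have "linear_map (Slq q) N ?f"
    by (intro linear_map_add linear_map_smult_vector N e(1) n)
  moreover have "?f (slq_gen q i) = n i" for i
    using n by (cases i) (simp_all add: e(2) module_groundD[OF N])
  ultimately show ?thesis using linear_map_slq_gen_span by blast
qed

section \<open>The antipode of the modified coproduct\<close>

fun antipode_gen :: "'k::field \<Rightarrow> slq_letter \<Rightarrow> (slq_letter word \<Rightarrow>\<^sub>0 'k) set" where
  "antipode_gen q La = slq_gen q La"
| "antipode_gen q Lb = (- inverse q) \<odot>\<^bsub>Slq q\<^esub> slq_gen q Lc"
| "antipode_gen q Lc = (- q) \<odot>\<^bsub>Slq q\<^esub> slq_gen q Lb"
| "antipode_gen q Ld = slq_gen q Ld"

lemma all_letters: "(\<forall>i. P i) \<longleftrightarrow> P La \<and> P Lb \<and> P Lc \<and> P Ld"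
  by (metis slq_letter.exhaust)

lemma is_S_tilde_iff:
  "is_S_tilde q S \<longleftrightarrow>
     linear_map (slq_gen_span q) (Slq q) S \<and> (\<forall>i. S (slq_gen q i) = antipode_gen q i)"
  unfolding is_S_tilde_def all_letters antipode_gen.simps by auto

context
  fixes q :: "'k::field"
begin

interpretation B: unital_algebra "Slq q" by (rule Slq_algebra)

private abbreviation (input) "a \<equiv> slq_gen q La"
private abbreviation (input) "b \<equiv> slq_gen q Lb"
private abbreviation (input) "c \<equiv> slq_gen q Lc"
private abbreviation (input) "d \<equiv> slq_gen q Ld"

lemma Slq_relations:
  "a \<otimes>\<^bsub>Slq q\<^esub> b = inverse q \<odot>\<^bsub>Slq q\<^esub> (b \<otimes>\<^bsub>Slq q\<^esub> a)"
  "a \<otimes>\<^bsub>Slq q\<^esub> c = inverse q \<odot>\<^bsub>Slq q\<^esub> (c \<otimes>\<^bsub>Slq q\<^esub> a)"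
  "b \<otimes>\<^bsub>Slq q\<^esub> d = inverse q \<odot>\<^bsub>Slq q\<^esub> (d \<otimes>\<^bsub>Slq q\<^esub> b)"
  "c \<otimes>\<^bsub>Slq q\<^esub> d = inverse q \<odot>\<^bsub>Slq q\<^esub> (d \<otimes>\<^bsub>Slq q\<^esub> c)"
  "b \<otimes>\<^bsub>Slq q\<^esub> c = c \<otimes>\<^bsub>Slq q\<^esub> b"
  "a \<otimes>\<^bsub>Slq q\<^esub> d = inverse q \<odot>\<^bsub>Slq q\<^esub> (b \<otimes>\<^bsub>Slq q\<^esub> c) \<oplus>\<^bsub>Slq q\<^esub> \<one>\<^bsub>Slq q\<^esub>"
  using slq_gen_relations[of q] unfolding sl_q_relations_def by - (elim conjE; assumption)+

lemma smult_add_collect: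
  assumes x: "x \<in> carrier (Slq q)"
  shows "u \<odot>\<^bsub>Slq q\<^esub> x \<oplus>\<^bsub>Slq q\<^esub> v \<odot>\<^bsub>Slq q\<^esub> x = (u + v) \<odot>\<^bsub>Slq q\<^esub> x"
    and "x \<oplus>\<^bsub>Slq q\<^esub> v \<odot>\<^bsub>Slq q\<^esub> x = (1 + v) \<odot>\<^bsub>Slq q\<^esub> x"
    and "u \<odot>\<^bsub>Slq q\<^esub> x \<oplus>\<^bsub>Slq q\<^esub> x = (u + 1) \<odot>\<^bsub>Slq q\<^esub> x"
    and "u \<odot>\<^bsub>Slq q\<^esub> (v \<odot>\<^bsub>Slq q\<^esub> x) = (u * v) \<odot>\<^bsub>Slq q\<^esub> x"
    and "y \<in> carrier (Slq q) \<Longrightarrow>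
      u \<odot>\<^bsub>Slq q\<^esub> x \<oplus>\<^bsub>Slq q\<^esub> (v \<odot>\<^bsub>Slq q\<^esub> x \<oplus>\<^bsub>Slq q\<^esub> y) = (u + v) \<odot>\<^bsub>Slq q\<^esub> x \<oplus>\<^bsub>Slq q\<^esub> y"
    and "y \<in> carrier (Slq q) \<Longrightarrow>
      (u \<odot>\<^bsub>Slq q\<^esub> x \<oplus>\<^bsub>Slq q\<^esub> y) \<oplus>\<^bsub>Slq q\<^esub> v \<odot>\<^bsub>Slq q\<^esub> x = (u + v) \<odot>\<^bsub>Slq q\<^esub> x \<oplus>\<^bsub>Slq q\<^esub> y"
proof -
  note mod = module_groundD(1,2,5)[OF B.module x]
  show "u \<odot>\<^bsub>Slq q\<^esub> x \<oplus>\<^bsub>Slq q\<^esub> v \<odot>\<^bsub>Slq q\<^esub> x = (u + v) \<odot>\<^bsub>Slq q\<^esub> x"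
    "x \<oplus>\<^bsub>Slq q\<^esub> v \<odot>\<^bsub>Slq q\<^esub> x = (1 + v) \<odot>\<^bsub>Slq q\<^esub> x"
    "u \<odot>\<^bsub>Slq q\<^esub> x \<oplus>\<^bsub>Slq q\<^esub> x = (u + 1) \<odot>\<^bsub>Slq q\<^esub> x"
    by (simp_all only: mod)
  show "u \<odot>\<^bsub>Slq q\<^esub> (v \<odot>\<^bsub>Slq q\<^esub> x) = (u * v) \<odot>\<^bsub>Slq q\<^esub> x"
    by (simp only: module_groundD(4)[OF B.module x])
  assume y: "y \<in> carrier (Slq q)"
  show "u \<odot>\<^bsub>Slq q\<^esub> x \<oplus>\<^bsub>Slq q\<^esub> (v \<odot>\<^bsub>Slq q\<^esub> x \<oplus>\<^bsub>Slq q\<^esub> y) = (u + v) \<odot>\<^bsub>Slq q\<^esub> x \<oplus>\<^bsub>Slq q\<^esub> y"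
    by (simp only: mod y B.a_assoc)
  have "(u \<odot>\<^bsub>Slq q\<^esub> x \<oplus>\<^bsub>Slq q\<^esub> y) \<oplus>\<^bsub>Slq q\<^esub> v \<odot>\<^bsub>Slq q\<^esub> x =
      u \<odot>\<^bsub>Slq q\<^esub> x \<oplus>\<^bsub>Slq q\<^esub> (v \<odot>\<^bsub>Slq q\<^esub> x \<oplus>\<^bsub>Slq q\<^esub> y)"
    by (simp only: mod y B.a_assoc B.a_comm[of y])
  then show "(u \<odot>\<^bsub>Slq q\<^esub> x \<oplus>\<^bsub>Slq q\<^esub> y) \<oplus>\<^bsub>Slq q\<^esub> v \<odot>\<^bsub>Slq q\<^esub> x = (u + v) \<odot>\<^bsub>Slq q\<^esub> x \<oplus>\<^bsub>Slq q\<^esub> y"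
    by (simp only: mod y B.a_assoc)
qed

text \<open>Eliminating \<open>ad\<close> from the last two relations leaves this formula for the opposite product; it is
  used whenever a computation produces \<open>da\<close>.\<close>

lemma Slq_da:
  "d \<otimes>\<^bsub>Slq q\<^esub> a = q \<odot>\<^bsub>Slq q\<^esub> (b \<otimes>\<^bsub>Slq q\<^esub> c) \<oplus>\<^bsub>Slq q\<^esub> \<one>\<^bsub>Slq q\<^esub>"
proof -
  let ?bc = "b \<otimes>\<^bsub>Slq q\<^esub> c"
  have bc: "?bc \<in> carrier (Slq q)" by (simp add: slq_gen_closed)
  note closed = bc module_groundD(1)[OF B.module bc] slq_gen_closed
  have "a \<otimes>\<^bsub>Slq q\<^esub> d = d \<otimes>\<^bsub>Slq q\<^esub> a \<oplus>\<^bsub>Slq q\<^esub> (inverse q - q) \<odot>\<^bsub>Slq q\<^esub> ?bc"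
    using slq_gen_relations[of q] by (simp add: sl_q_relations_def)
  also have "\<dots> = (inverse q - q) \<odot>\<^bsub>Slq q\<^esub> ?bc \<oplus>\<^bsub>Slq q\<^esub> d \<otimes>\<^bsub>Slq q\<^esub> a"
    by (simp add: B.a_comm closed)
  finally have "(inverse q - q) \<odot>\<^bsub>Slq q\<^esub> ?bc \<oplus>\<^bsub>Slq q\<^esub> d \<otimes>\<^bsub>Slq q\<^esub> a =
      (inverse q - q) \<odot>\<^bsub>Slq q\<^esub> ?bc \<oplus>\<^bsub>Slq q\<^esub> (q \<odot>\<^bsub>Slq q\<^esub> ?bc \<oplus>\<^bsub>Slq q\<^esub> \<one>\<^bsub>Slq q\<^esub>)"
    by (simp add: Slq_relations smult_add_collect closed)
  then show ?thesis
    by (simp add: closed)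
qed

text \<open>As rewrite rules these bring every expression occurring below to a linear combination of \<open>1\<close>, \<open>ba\<close>,
  \<open>ca\<close>, \<open>db\<close>, \<open>dc\<close> and \<open>cb\<close> with collected coefficients, where equality can be read off.\<close>

lemmas Slq_normalize =
  Slq_relations Slq_da B.smult_mult_left B.smult_mult_right smult_add_collect slq_gen_closed
  module_groundD(1,5,6)[OF B.module]

lemma antipode_gen_closed: "antipode_gen q i \<in> carrier (Slq q)"
  by (cases i) (simp_all add: Slq_normalize)

lemma qdet_eq_one: "qdet (Slq q) q a b c d = \<one>\<^bsub>Slq q\<^esub>"
proof -
  have closed: "b \<otimes>\<^bsub>Slq q\<^esub> c \<in> carrier (Slq q)" by (simp add: slq_gen_closed)
  show ?thesis
    unfolding qdet_def a_minus_def module_groundD(7)[OF B.module closed, symmetric]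
    by (simp add: Slq_normalize)
qed

text \<open>The convolution \<open>m (f \<otimes> g) \<Delta>\<close> and the map \<open>\<epsilon> \<cdot> 1\<close> are linear on the span, so only the four values on the
  generators matter, and there the convolution is the sum of two products dictated by \<open>\<Delta>\<close>.\<close>

lemma convolution_eqI:
  assumes \<Delta>: "is_Delta_tilde q \<Delta>" and \<epsilon>: "is_eps_tilde q \<epsilon>"
    and f: "linear_map (slq_gen_span q) (Slq q) f" and g: "linear_map (slq_gen_span q) (Slq q) g"
    and conv:
      "f b \<otimes>\<^bsub>Slq q\<^esub> g a \<oplus>\<^bsub>Slq q\<^esub> f a \<otimes>\<^bsub>Slq q\<^esub> g c = \<zero>\<^bsub>Slq q\<^esub>"
      "f b \<otimes>\<^bsub>Slq q\<^esub> g b \<oplus>\<^bsub>Slq q\<^esub> f a \<otimes>\<^bsub>Slq q\<^esub> g d = \<one>\<^bsub>Slq q\<^esub>"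
      "f c \<otimes>\<^bsub>Slq q\<^esub> g c \<oplus>\<^bsub>Slq q\<^esub> f d \<otimes>\<^bsub>Slq q\<^esub> g a = \<one>\<^bsub>Slq q\<^esub>"
      "f c \<otimes>\<^bsub>Slq q\<^esub> g d \<oplus>\<^bsub>Slq q\<^esub> f d \<otimes>\<^bsub>Slq q\<^esub> g b = \<zero>\<^bsub>Slq q\<^esub>"
    and x: "x \<in> carrier (slq_gen_span q)"
  shows "product_map (Slq q) (tensor_map (Slq q) (Slq q) f g (\<Delta> x)) = \<epsilon> x \<odot>\<^bsub>Slq q\<^esub> \<one>\<^bsub>Slq q\<^esub>"
proof (rule linear_map_eq_on_slq_gen_span[OF B.module _ _ _ x])
  let ?V = "slq_gen_span q"
  let ?\<mu> = "\<lambda>t. product_map (Slq q) (tensor_map (Slq q) (Slq q) f g t)"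
  note V = slq_gen_span_module
  note \<Delta>' = \<Delta>[unfolded is_Delta_tilde_def Let_def]
  note \<mu> = product_map_tensor_map_linear[OF Slq_algebra V f g]
    and \<mu>_pure = product_map_tensor_map_pure[OF Slq_algebra V f g]
  show "linear_map ?V (Slq q) (\<lambda>x. ?\<mu> (\<Delta> x))"
    using \<Delta>' by (intro linear_map_compose[OF _ \<mu>]) blast
  show "linear_map ?V (Slq q) (\<lambda>x. \<epsilon> x \<odot>\<^bsub>Slq q\<^esub> \<one>\<^bsub>Slq q\<^esub>)"
    using \<epsilon> by (intro linear_map_smult_vector B.module) (auto simp: is_eps_tilde_def)
  have \<mu>_sum: "?\<mu> (pure_tensor ?V ?V u v \<oplus>\<^bsub>tensor ?V ?V\<^esub> pure_tensor ?V ?V u' v') =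
      f u \<otimes>\<^bsub>Slq q\<^esub> g v \<oplus>\<^bsub>Slq q\<^esub> f u' \<otimes>\<^bsub>Slq q\<^esub> g v'"
    if "u \<in> carrier ?V" "v \<in> carrier ?V" "u' \<in> carrier ?V" "v' \<in> carrier ?V" for u v u' v'
    using that by (simp add: linear_mapD(2)[OF \<mu>] pure_tensor_closed[OF V V] \<mu>_pure)
  show "?\<mu> (\<Delta> (slq_gen q i)) = \<epsilon> (slq_gen q i) \<odot>\<^bsub>Slq q\<^esub> \<one>\<^bsub>Slq q\<^esub>" for i
    using \<Delta>' \<epsilon> unfolding is_eps_tilde_def
    by (cases i) (simp_all add: \<mu>_sum slq_gen_in_span conv module_groundD(5,6)[OF B.module])
qed

context
  assumes q: "q \<noteq> 0"
begin

text \<open>Up to scalars the antipode exchanges \<open>b\<close> and \<open>c\<close> and fixes \<open>a\<close> and \<open>d\<close>. The relations are symmetric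
  under this exchange. Those containing just one of \<open>b\<close> and \<open>c\<close> are homogeneous in it, so the scalar
  drops out; in the product \<open>bc\<close> the scalars \<open>- inverse q\<close> and \<open>- q\<close> multiply to \<open>1\<close>.\<close>

lemma antipode_gen_relations: "sl_q_relations (Slq q) q (antipode_gen q)"
  unfolding sl_q_relations_def
  using q by (simp add: antipode_gen_closed del: antipode_gen.simps)
    (simp add: Slq_normalize)

lemma antipode_identities:
  "b \<otimes>\<^bsub>Slq q\<^esub> antipode_gen q La \<oplus>\<^bsub>Slq q\<^esub> a \<otimes>\<^bsub>Slq q\<^esub> antipode_gen q Lc = \<zero>\<^bsub>Slq q\<^esub>"
  "b \<otimes>\<^bsub>Slq q\<^esub> antipode_gen q Lb \<oplus>\<^bsub>Slq q\<^esub> a \<otimes>\<^bsub>Slq q\<^esub> antipode_gen q Ld = \<one>\<^bsub>Slq q\<^esub>"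
  "c \<otimes>\<^bsub>Slq q\<^esub> antipode_gen q Lc \<oplus>\<^bsub>Slq q\<^esub> d \<otimes>\<^bsub>Slq q\<^esub> antipode_gen q La = \<one>\<^bsub>Slq q\<^esub>"
  "c \<otimes>\<^bsub>Slq q\<^esub> antipode_gen q Ld \<oplus>\<^bsub>Slq q\<^esub> d \<otimes>\<^bsub>Slq q\<^esub> antipode_gen q Lb = \<zero>\<^bsub>Slq q\<^esub>"
  "antipode_gen q Lb \<otimes>\<^bsub>Slq q\<^esub> a \<oplus>\<^bsub>Slq q\<^esub> antipode_gen q La \<otimes>\<^bsub>Slq q\<^esub> c = \<zero>\<^bsub>Slq q\<^esub>"
  "antipode_gen q Lb \<otimes>\<^bsub>Slq q\<^esub> b \<oplus>\<^bsub>Slq q\<^esub> antipode_gen q La \<otimes>\<^bsub>Slq q\<^esub> d = \<one>\<^bsub>Slq q\<^esub>"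
  "antipode_gen q Lc \<otimes>\<^bsub>Slq q\<^esub> c \<oplus>\<^bsub>Slq q\<^esub> antipode_gen q Ld \<otimes>\<^bsub>Slq q\<^esub> a = \<one>\<^bsub>Slq q\<^esub>"
  "antipode_gen q Lc \<otimes>\<^bsub>Slq q\<^esub> d \<oplus>\<^bsub>Slq q\<^esub> antipode_gen q Ld \<otimes>\<^bsub>Slq q\<^esub> b = \<zero>\<^bsub>Slq q\<^esub>"
  using q by (simp_all add: Slq_normalize)

text \<open>The images of the generators satisfy the defining relations, so the universal property yields an
  algebra map; it agrees with \<open>S\<close> on generators and therefore on their span.\<close>

lemma antipode_extension:
  assumes S: "is_S_tilde q S"
  shows "\<exists>\<phi>. algebra_map (Slq q) (Slq q) \<phi> \<and> (\<forall>x\<in>carrier (slq_gen_span q). \<phi> x = S x)"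
proof -
  obtain \<phi> where \<phi>: "algebra_map (Slq q) (Slq q) \<phi>" "\<And>i. \<phi> (slq_gen q i) = antipode_gen q i"
    using Slq_universal[OF Slq_algebra antipode_gen_relations] by blast
  have lin: "linear_map (slq_gen_span q) (Slq q) \<phi>"
    using linear_map_slq_gen_span[OF algebra_mapD(1)[OF \<phi>(1)]] .
  have "\<phi> x = S x" if "x \<in> carrier (slq_gen_span q)" for x
    by (rule linear_map_eq_on_slq_gen_span[OF B.module lin _ _ that])
      (use S in \<open>simp_all only: is_S_tilde_iff \<phi>(2)\<close>)
  with \<phi>(1) show ?thesis by blast
qed

lemma antipode_convolution:
  assumes \<Delta>: "is_Delta_tilde q \<Delta>" and \<epsilon>: "is_eps_tilde q \<epsilon>" and S: "is_S_tilde q S"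
    and x: "x \<in> carrier (slq_gen_span q)"
  shows "product_map (Slq q) (tensor_map (Slq q) (Slq q) id S (\<Delta> x)) = \<epsilon> x \<odot>\<^bsub>Slq q\<^esub> \<one>\<^bsub>Slq q\<^esub>"
    and "product_map (Slq q) (tensor_map (Slq q) (Slq q) S id (\<Delta> x)) = \<epsilon> x \<odot>\<^bsub>Slq q\<^esub> \<one>\<^bsub>Slq q\<^esub>"
proof -
  have lin_id: "linear_map (slq_gen_span q) (Slq q) id"
    by (intro linear_map_slq_gen_span linear_mapI) simp_all
  have lin_S: "linear_map (slq_gen_span q) (Slq q) S"
    and S_gen: "\<And>i. S (slq_gen q i) = antipode_gen q i"
    using S by (simp_all add: is_S_tilde_iff)
  show "product_map (Slq q) (tensor_map (Slq q) (Slq q) id S (\<Delta> x)) = \<epsilon> x \<odot>\<^bsub>Slq q\<^esub> \<one>\<^bsub>Slq q\<^esub>"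
    by (rule convolution_eqI[OF \<Delta> \<epsilon> lin_id lin_S _ _ _ _ x]; unfold id_apply S_gen; rule antipode_identities)
  show "product_map (Slq q) (tensor_map (Slq q) (Slq q) S id (\<Delta> x)) = \<epsilon> x \<odot>\<^bsub>Slq q\<^esub> \<one>\<^bsub>Slq q\<^esub>"
    by (rule convolution_eqI[OF \<Delta> \<epsilon> lin_S lin_id _ _ _ _ x]; unfold id_apply S_gen; rule antipode_identities)
qed

context
  assumes two: "(2::'k) \<noteq> 0"
begin

lemma Delta_tilde_exists: "\<exists>\<Delta>. is_Delta_tilde q \<Delta>"
proof -
  let ?V = "slq_gen_span q"
  let ?T = "tensor ?V ?V" and ?t = "pure_tensor ?V ?V"
  let ?n = "\<lambda>i. case i of La \<Rightarrow> ?t b a \<oplus>\<^bsub>?T\<^esub> ?t a c | Lb \<Rightarrow> ?t b b \<oplus>\<^bsub>?T\<^esub> ?t a d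
    | Lc \<Rightarrow> ?t c c \<oplus>\<^bsub>?T\<^esub> ?t d a | Ld \<Rightarrow> ?t c d \<oplus>\<^bsub>?T\<^esub> ?t d b"
  note V = slq_gen_span_module
  interpret T: module ground ?T by (rule tensor_module[OF V V])
  have "?n i \<in> carrier ?T" for i
    by (cases i) (simp_all add: pure_tensor_closed[OF V V] slq_gen_in_span)
  from linear_map_from_slq_gen_span[OF q two T.module_axioms, of ?n, OF this]
  show ?thesis unfolding all_letters is_Delta_tilde_def Let_def by simp
qed

lemma eps_tilde_exists: "\<exists>\<epsilon>. is_eps_tilde q \<epsilon>"
proof -
  let ?n = "\<lambda>i. case i of La \<Rightarrow> 0 | Lb \<Rightarrow> 1 | Lc \<Rightarrow> 1 | Ld \<Rightarrow> (0::'k)"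
  have "\<exists>f. linear_map (slq_gen_span q) ground_module f \<and> (\<forall>i. f (slq_gen q i) = ?n i)"
    by (rule linear_map_from_slq_gen_span[OF q two ground_module_module]) (simp add: ground_module_def)
  then show ?thesis unfolding all_letters is_eps_tilde_def by auto
qed

lemma S_tilde_exists: "\<exists>S. is_S_tilde q S"
  unfolding is_S_tilde_iff
  by (rule linear_map_from_slq_gen_span[OF q two B.module antipode_gen_closed])

end

text \<open>The product \<open>bc\<close> is fixed because its image is \<open>(- inverse q)(- q) cb = bc\<close>.\<close>

lemma antipode_fixed_points:
  assumes S: "is_S_tilde q S" and \<phi>: "algebra_map (Slq q) (Slq q) \<phi>"
    and ext: "\<And>x. x \<in> carrier (slq_gen_span q) \<Longrightarrow> \<phi> x = S x"
  shows "\<phi> a = a" and "\<phi> d = d" and "\<phi> (b \<otimes>\<^bsub>Slq q\<^esub> c) = b \<otimes>\<^bsub>Slq q\<^esub> c"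
proof -
  have gen: "\<phi> (slq_gen q i) = antipode_gen q i" for i
    using ext[OF slq_gen_in_span] S by (simp add: is_S_tilde_iff)
  show "\<phi> a = a" "\<phi> d = d" by (simp_all add: gen)
  show "\<phi> (b \<otimes>\<^bsub>Slq q\<^esub> c) = b \<otimes>\<^bsub>Slq q\<^esub> c"
    using q by (simp add: algebra_mapD(3)[OF \<phi>] gen Slq_normalize)
qed

end

end

theorem proposition3p6:
  fixes q :: "'k::real_normed_field"
  assumes "q \<noteq> 0"
  shows
    "(\<exists>\<Delta>. is_Delta_tilde q \<Delta>) \<and> (\<exists>\<epsilon>. is_eps_tilde q \<epsilon>) \<and> (\<exists>S. is_S_tilde q S) \<and>
     (\<forall>\<Delta> \<epsilon> S. is_Delta_tilde q \<Delta> \<and> is_eps_tilde q \<epsilon> \<and> is_S_tilde q S \<longrightarrow>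
       (\<forall>x \<in> carrier (slq_gen_span q).
          product_map (Slq q) (tensor_map (Slq q) (Slq q) id S (\<Delta> x)) = \<epsilon> x \<odot>\<^bsub>Slq q\<^esub> \<one>\<^bsub>Slq q\<^esub> \<and>
          product_map (Slq q) (tensor_map (Slq q) (Slq q) S id (\<Delta> x)) = \<epsilon> x \<odot>\<^bsub>Slq q\<^esub> \<one>\<^bsub>Slq q\<^esub>) \<and>
       (\<exists>\<phi>. algebra_map (Slq q) (Slq q) \<phi> \<and> (\<forall>x \<in> carrier (slq_gen_span q). \<phi> x = S x)) \<and>
       (\<forall>\<phi>. algebra_map (Slq q) (Slq q) \<phi> \<and> (\<forall>x \<in> carrier (slq_gen_span q). \<phi> x = S x) \<longrightarrow>
          \<phi> \<one>\<^bsub>Slq q\<^esub> = \<one>\<^bsub>Slq q\<^esub> \<and>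
          \<phi> (slq_gen q La) = slq_gen q La \<and>
          \<phi> (slq_gen q Ld) = slq_gen q Ld \<and>
          \<phi> (slq_gen q Lb \<otimes>\<^bsub>Slq q\<^esub> slq_gen q Lc) = slq_gen q Lb \<otimes>\<^bsub>Slq q\<^esub> slq_gen q Lc \<and>
          \<phi> (qdet (Slq q) q (slq_gen q La) (slq_gen q Lb) (slq_gen q Lc) (slq_gen q Ld)) =
            qdet (Slq q) q (slq_gen q La) (slq_gen q Lb) (slq_gen q Lc) (slq_gen q Ld)))"
proof (intro conjI allI impI ballI; (elim conjE)?)
  have two: "(2::'k) \<noteq> 0" by simp
  show "\<exists>\<Delta>. is_Delta_tilde q \<Delta>" by (rule Delta_tilde_exists[OF assms two])
  show "\<exists>\<epsilon>. is_eps_tilde q \<epsilon>" by (rule eps_tilde_exists[OF assms two])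
  show "\<exists>S. is_S_tilde q S" by (rule S_tilde_exists[OF assms two])
  fix \<Delta> \<epsilon> S
  assume \<Delta>: "is_Delta_tilde q \<Delta>" and \<epsilon>: "is_eps_tilde q \<epsilon>" and S: "is_S_tilde q S"
  show "product_map (Slq q) (tensor_map (Slq q) (Slq q) id S (\<Delta> x)) = \<epsilon> x \<odot>\<^bsub>Slq q\<^esub> \<one>\<^bsub>Slq q\<^esub>"
    "product_map (Slq q) (tensor_map (Slq q) (Slq q) S id (\<Delta> x)) = \<epsilon> x \<odot>\<^bsub>Slq q\<^esub> \<one>\<^bsub>Slq q\<^esub>"
    if "x \<in> carrier (slq_gen_span q)" for x
    using antipode_convolution[OF assms \<Delta> \<epsilon> S that] .
  show "\<exists>\<phi>. algebra_map (Slq q) (Slq q) \<phi> \<and> (\<forall>x \<in> carrier (slq_gen_span q). \<phi> x = S x)"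
    by (rule antipode_extension[OF assms S])
  fix \<phi> assume \<phi>: "algebra_map (Slq q) (Slq q) \<phi>"
    and "\<forall>x \<in> carrier (slq_gen_span q). \<phi> x = S x"
  then have ext: "\<And>x. x \<in> carrier (slq_gen_span q) \<Longrightarrow> \<phi> x = S x" by blast
  show one: "\<phi> \<one>\<^bsub>Slq q\<^esub> = \<one>\<^bsub>Slq q\<^esub>" by (rule algebra_mapD(2)[OF \<phi>])
  show "\<phi> (slq_gen q La) = slq_gen q La" "\<phi> (slq_gen q Ld) = slq_gen q Ld"
    "\<phi> (slq_gen q Lb \<otimes>\<^bsub>Slq q\<^esub> slq_gen q Lc) = slq_gen q Lb \<otimes>\<^bsub>Slq q\<^esub> slq_gen q Lc"
    by (rule antipode_fixed_points[OF assms S \<phi> ext]; assumption)+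
  show "\<phi> (qdet (Slq q) q (slq_gen q La) (slq_gen q Lb) (slq_gen q Lc) (slq_gen q Ld)) =
      qdet (Slq q) q (slq_gen q La) (slq_gen q Lb) (slq_gen q Lc) (slq_gen q Ld)"
    \<comment> \<open>The determinant is the unit, by the last defining relation.\<close>
    unfolding qdet_eq_one by (rule one)
qed

end
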